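(* Let $b\ge a\ge 1$ be integers. Then, as $n\to\infty$, $$Rt_4(K_{a,b};K_n)=\begin{cases}\displaystyle\left(\frac{1}{4a+b}+o(1)\right)n, & b\le 3a,\\[2ex] \displaystyle\left(\frac{2}{5a+3b}+o(1)\right)n, & 3a\le b\le 5a,\\[2ex] \displaystyle\left(\frac{3}{5(a+b)}+o(1)\right)n, & b\ge 5a.\end{cases}$$
   Context: $K_{a,b}$ is the complete bipartite graph with classes of sizes $a$ and $b$. For an edge-colouring $\chi:E(K_n)\to[r]$ and a graph $H$, let $\nu_H(\chi)$ be the maximum over colours $\ell\in[r]$ of the maximum number of vertex-disjoint copies of $H$ all of whose edges have colour $\ell$. Then $Rt_r(H;K_n):=\min_{\chi:E(K_n)\to[r]}\nu_H(\chi)$. *)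

theory Defs
  imports Complex_Main "HOL-Library.FuncSet" "HOL-Library.Ramsey" "HOL-Library.Landau_Symbols"
begin

text \<open>
  A simple graph is a pair of a vertex set and an edge set, the edges being two-element sets of
  vertices.
\<close>

type_synonym 'a ugraph = "'a set \<times> 'a set set"

abbreviation vertices :: "'a ugraph \<Rightarrow> 'a set" where
  "vertices G \<equiv> fst G"

abbreviation edges :: "'a ugraph \<Rightarrow> 'a set set" where
  "edges G \<equiv> snd G"

definition complete_graph :: "nat \<Rightarrow> nat ugraph" where
  "complete_graph n = ({1..n}, [{1..n}]\<^bsup>2\<^esup>)"

definition complete_bipartite :: "nat \<Rightarrow> nat \<Rightarrow> (nat + nat) ugraph" where
  "complete_bipartite a b =
     ({1..a} <+> {1..b}, {{Inl i, Inr j} | i j. i \<in> {1..a} \<and> j \<in> {1..b}})"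

definition isomorphic :: "'a ugraph \<Rightarrow> 'b ugraph \<Rightarrow> bool" where
  "isomorphic H C \<longleftrightarrow>
     (\<exists>f. bij_betw f (vertices H) (vertices C) \<and> edges C = (\<lambda>e. f ` e) ` edges H)"

text \<open>Copies are subgraphs that need not be induced.\<close>

definition copies :: "'a ugraph \<Rightarrow> 'b ugraph \<Rightarrow> 'b ugraph set" where
  "copies H G =
     {C. vertices C \<subseteq> vertices G \<and> edges C \<subseteq> edges G \<and> isomorphic H C}"

definition edge_colourings :: "nat \<Rightarrow> 'b ugraph \<Rightarrow> ('b set \<Rightarrow> nat) set" where
  "edge_colourings r G = edges G \<rightarrow>\<^sub>E {1..r}"

definition mono_copies ::
    "'a ugraph \<Rightarrow> 'b ugraph \<Rightarrow> ('b set \<Rightarrow> nat) \<Rightarrow> nat \<Rightarrow> 'b ugraph set" where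
  "mono_copies H G \<chi> l = {C \<in> copies H G. \<forall>e \<in> edges C. \<chi> e = l}"

definition vertex_disjoint :: "'b ugraph set \<Rightarrow> bool" where
  "vertex_disjoint F \<longleftrightarrow> pairwise (\<lambda>C D. disjnt (vertices C) (vertices D)) F"

definition mono_packing_number ::
    "'a ugraph \<Rightarrow> 'b ugraph \<Rightarrow> ('b set \<Rightarrow> nat) \<Rightarrow> nat \<Rightarrow> nat" where
  "mono_packing_number H G \<chi> l =
     Max {card F | F. F \<subseteq> mono_copies H G \<chi> l \<and> vertex_disjoint F}"

definition nu :: "nat \<Rightarrow> 'a ugraph \<Rightarrow> 'b ugraph \<Rightarrow> ('b set \<Rightarrow> nat) \<Rightarrow> nat" where
  "nu r H G \<chi> = (MAX l \<in> {1..r}. mono_packing_number H G \<chi> l)"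

text \<open>
  For finite \<open>G\<close> and \<open>r \<ge> 1\<close>, all minima and maxima here range over finite nonempty sets.
\<close>

definition Rt :: "nat \<Rightarrow> 'a ugraph \<Rightarrow> 'b ugraph \<Rightarrow> nat" where
  "Rt r H G = (MIN \<chi> \<in> edge_colourings r G. nu r H G \<chi>)"

text \<open>\<open>f n = (c + o(1)) n\<close> as \<open>n\<close> tends to infinity\<close>

definition asymp_linear :: "(nat \<Rightarrow> nat) \<Rightarrow> real \<Rightarrow> bool" where
  "asymp_linear f c \<longleftrightarrow>
     (\<exists>\<epsilon> :: nat \<Rightarrow> real. \<epsilon> \<in> o(\<lambda>_. 1) \<and>
        (\<forall>\<^sub>F n in sequentially. real (f n) = (c + \<epsilon> n) * real n))"

end

theory Submission
  imports Defs "HOL-Analysis.Henstock_Kurzweil_Integration"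
begin

text \<open>
  For the upper bounds, give every vertex a type 0, 1 or 2 in each of the four colours such that any
  two vertices have a colour in which their types add up to at least 2, and give the edge between them such
  a colour. Let the types cost \<open>0\<close>, \<open>1 / (a + b)\<close> and \<open>1 / a\<close>. Every copy of \<open>K\<^bsub>a,b\<^esub>\<close> in colour \<open>l\<close>
  costs at least 1 in that colour, so the total cost in colour \<open>l\<close> bounds the number of disjoint copies
  (\<open>packing_le_cost\<close>). Three tables of types (\<open>Rt_upper_bounds\<close>) give the three densities; each is
  the smallest one in its range of \<open>b / a\<close>.

  The lower bound shows that typings of this kind are essentially optimal. Fix a colouring and a
  large constant \<open>L\<close>. In each colour, the multiplicative weights method (\<open>packing_or_cover\<close>) yields
  either many bicliques \<open>K\<^bsub>aL,bL\<^esub>\<close> that use every vertex at most \<open>L\<close> times, or a fractional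
  cover of these bicliques of small total value. In the first case Hall's theorem thins out the
  bicliques to equally many disjoint copies of \<open>K\<^bsub>a,b\<^esub>\<close> (\<open>disjoint_selection\<close>). Passing to blown-up
  bicliques is what makes fractional packings integral; it costs nothing, since every dense bipartite
  graph contains them.

  Suppose the second case holds in all four colours. The covers take boundedly many values, so all
  but boundedly many vertices lie in classes large enough for Ramsey's theorem to find, between any
  two of them, a colour whose cover covers an edge between the classes. Threshold rounding
  (\<open>threshold_rounding\<close>) replaces the values of the covers by types without increasing the total
  cost by more than 1. A vertex either has type 2 somewhere or is described by the set of colours in which it has
  type 1, and these sets form an intersecting family on four points. Such a family contains a
  singleton, contains a triangle, or has all its pairs through one point
  (\<open>intersecting_family_weights\<close>), and in each form linear programming duality bounds the number of vertices
  in terms of the cost per colour. The bounds are \<open>4 * a + b\<close>, \<open>(5 * a + 3 * b) / 2\<close> and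
  \<open>max (3 * a + b) (5 * (a + b) / 3)\<close> times the cost, and their maximum matches the best of the
  three tables.
\<close>

section \<open>Disjoint selections from bounded overlaps\<close>

text \<open>
  Rado's deletion argument: as long as some set has two elements, one of them can be removed
  without violating Hall's condition. Otherwise the removals of two elements create violating
  families \<open>J\<close> and \<open>K\<close>, and submodularity of the size of a union, applied to \<open>J \<union> K\<close> and
  \<open>J \<inter> K - {i}\<close>, gives a contradiction.
\<close>

lemma hall_marriage:
  fixes A :: "'i \<Rightarrow> 'v set"
  assumes "finite I" and "\<And>i. i \<in> I \<Longrightarrow> finite (A i)"
    and "\<And>J. J \<subseteq> I \<Longrightarrow> card J \<le> card (\<Union>(A ` J))"
  shows "\<exists>f. inj_on f I \<and> (\<forall>i\<in>I. f i \<in> A i)"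
  using assms(2,3)
proof (induction "\<Sum>i\<in>I. card (A i)" arbitrary: A rule: less_induct)
  case less
  note fin = less.prems(1) and hall = less.prems(2)
  have ne: "A i \<noteq> {}" if "i \<in> I" for i
    using hall[of "{i}"] that by auto
  show ?case
  proof (cases "\<exists>i\<in>I. \<exists>x\<in>A i. \<exists>y\<in>A i. x \<noteq> y")
    case False
    define f where "f i = (SOME x. x \<in> A i)" for i
    have f: "f i \<in> A i" if "i \<in> I" for i
      using ne[OF that] unfolding f_def by (simp add: some_in_eq)
    have "inj_on f I"
    proof (rule inj_onI, rule ccontr)
      fix i j assume ij: "i \<in> I" "j \<in> I" "f i = f j" "i \<noteq> j"
      have "z = f k" if "k \<in> I" "z \<in> A k" for k z
        using False f that by blast
      then have "\<Union>(A ` {i, j}) \<subseteq> {f i}"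
        using ij by auto
      then have "card (\<Union>(A ` {i, j})) \<le> 1"
        using card_mono[of "{f i}"] by fastforce
      then show False using hall[of "{i, j}"] ij by simp
    qed
    then show ?thesis using f by blast
  next
    case True
    then obtain i x y where ixy: "i \<in> I" "x \<in> A i" "y \<in> A i" "x \<noteq> y" by blast
    define B where "B z = A(i := A i - {z})" for z
    have finB: "finite (B z j)" if "j \<in> I" for z j
      using fin[OF that] fin[OF ixy(1)] by (simp add: B_def)
    have step: ?thesis if z: "z \<in> A i" and H: "\<And>J. J \<subseteq> I \<Longrightarrow> card J \<le> card (\<Union>(B z ` J))" for z
    proof -
      have "(\<Sum>j\<in>I. card (B z j)) < (\<Sum>j\<in>I. card (A j))"
      proof (rule sum_strict_mono_ex1[OF assms(1)])
        show "\<forall>j\<in>I. card (B z j) \<le> card (A j)"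
          using fin by (auto simp: B_def intro: card_mono)
        show "\<exists>j\<in>I. card (B z j) < card (A j)"
          using ixy(1) card_Diff1_less[OF fin[OF ixy(1)] z] by (intro bexI[of _ i]) (simp_all add: B_def)
      qed
      from less.hyps[OF this finB H] obtain f where "inj_on f I" "\<forall>j\<in>I. f j \<in> B z j" by blast
      moreover have "B z j \<subseteq> A j" for j by (auto simp: B_def)
      ultimately show ?thesis by blast
    qed
    show ?thesis
    proof (rule ccontr)
      assume no: "\<not> ?thesis"
      from no step[OF ixy(2)] obtain J where J: "J \<subseteq> I" "card (\<Union>(B x ` J)) < card J"
        by (meson not_le)
      from no step[OF ixy(3)] obtain K where K: "K \<subseteq> I" "card (\<Union>(B y ` K)) < card K"
        by (meson not_le)
      have fJK: "finite J" "finite K" using J(1) K(1) assms(1) finite_subset by auto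
      have mem: "i \<in> S" if "S \<subseteq> I" "card (\<Union>(B z ` S)) < card S" for z S
      proof (rule ccontr)
        assume "i \<notin> S"
        then have "B z ` S = A ` S" by (auto simp: B_def)
        then show False using hall[OF that(1)] that(2) by simp
      qed
      have iJ: "i \<in> J" and iK: "i \<in> K" using mem J K by auto
      let ?P = "\<Union>(B x ` J)" and ?Q = "\<Union>(B y ` K)"
      have fPQ: "finite ?P" "finite ?Q" using fJK finB J(1) K(1) by auto
      \<comment> \<open>At \<open>i\<close> itself the two reduced sets miss different elements, so together they lose nothing.\<close>
      have "\<Union>(A ` (J \<union> K)) \<subseteq> ?P \<union> ?Q"
      proof
        fix v assume "v \<in> \<Union>(A ` (J \<union> K))"
        then obtain j where j: "j \<in> J \<union> K" "v \<in> A j" by blast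
        show "v \<in> ?P \<union> ?Q"
        proof (cases "j = i")
          case True
          then have "v \<in> B x i \<or> v \<in> B y i" using j ixy(4) by (auto simp: B_def)
          then show ?thesis using iJ iK by blast
        next
          case False
          then have "v \<in> B x j" "v \<in> B y j" using j by (auto simp: B_def)
          then show ?thesis using j by blast
        qed
      qed
      then have "card (J \<union> K) \<le> card (?P \<union> ?Q)"
        by (intro order_trans[OF hall card_mono]) (use J(1) K(1) fPQ in auto)
      moreover have "card (J \<inter> K - {i}) \<le> card (?P \<inter> ?Q)"
      proof (rule order_trans[OF hall card_mono])
        show "\<Union>(A ` (J \<inter> K - {i})) \<subseteq> ?P \<inter> ?Q" by (auto simp: B_def)
      qed (use J(1) fPQ in auto)
      moreover have "card (J \<inter> K) = card (J \<inter> K - {i}) + 1"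
        using iJ iK fJK by (metis Int_iff One_nat_def Suc_eq_plus1 card_Suc_Diff1 finite_Int)
      moreover have "card J + card K = card (J \<union> K) + card (J \<inter> K)"
        using fJK card_Un_Int by blast
      moreover have "card ?P + card ?Q = card (?P \<union> ?Q) + card (?P \<inter> ?Q)"
        using fPQ card_Un_Int by blast
      ultimately show False using J(2) K(2) by linarith
    qed
  qed
qed

text \<open>
  If each element \<open>v\<close> spends \<open>1 / L\<close> on every set containing it, no element is overspent and every
  set \<open>Z j\<close> receives \<open>d j\<close>. Hall's theorem, with \<open>d j\<close> copies of each \<open>Z j\<close>, makes this fractional
  assignment integral. Any subsets of the two sides of a biclique again span a biclique, and therefore
  an \<open>L\<close>-fold packing of \<open>K\<^bsub>aL,bL\<^esub>\<close> yields equally many disjoint \<open>K\<^bsub>a,b\<^esub>\<close>.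
\<close>

lemma disjoint_selection:
  fixes Z :: "'j \<Rightarrow> 'v set" and d :: "'j \<Rightarrow> nat"
  assumes J: "finite J" and L: "L > 0"
    and Z: "\<And>j. j \<in> J \<Longrightarrow> finite (Z j) \<and> card (Z j) = d j * L"
    and deg: "\<And>v. card {j \<in> J. v \<in> Z j} \<le> L"
  shows "\<exists>Z'. (\<forall>j\<in>J. Z' j \<subseteq> Z j \<and> card (Z' j) = d j) \<and> disjoint_family_on Z' J"
proof -
  \<comment> \<open>The pairs \<open>(j, k)\<close> are the \<open>d j\<close> demands of the set \<open>Z j\<close>.\<close>
  define I where "I = (SIGMA j:J. {..<d j})"
  have finI: "finite I" using J by (simp add: I_def)
  have "\<exists>f. inj_on f I \<and> (\<forall>i\<in>I. f i \<in> Z (fst i))"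
  proof (rule hall_marriage[OF finI])
    show "finite (Z (fst i))" if "i \<in> I" for i using that Z by (auto simp: I_def)
    fix I' assume I': "I' \<subseteq> I"
    define J' where "J' = fst ` I'"
    have J': "J' \<subseteq> J" "finite J'"
      using I' finI finite_subset by (auto simp: J'_def I_def)
    define U where "U = \<Union>(Z ` J')"
    have finU: "finite U" using J' Z by (auto simp: U_def)
    have "I' \<subseteq> (SIGMA j:J'. {..<d j})" using I' by (force simp: J'_def I_def)
    then have "card I' \<le> card (SIGMA j:J'. {..<d j})"
      using J'(2) by (intro card_mono) auto
    also have "\<dots> = (\<Sum>j\<in>J'. d j)" using J'(2) by simp
    finally have 1: "card I' \<le> (\<Sum>j\<in>J'. d j)" .
    have "(\<Sum>j\<in>J'. d j) * L = (\<Sum>j\<in>J'. card (Z j))"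
      unfolding sum_distrib_right using J' Z by (intro sum.cong) auto
    also have "\<dots> = (\<Sum>j\<in>J'. \<Sum>v\<in>U. if v \<in> Z j then 1 else 0)"
    proof (rule sum.cong[OF refl])
      fix j assume "j \<in> J'"
      then have "Z j \<inter> U = Z j" by (auto simp: U_def)
      then show "card (Z j) = (\<Sum>v\<in>U. if v \<in> Z j then 1 else 0)"
        using finU by (simp add: sum.If_cases Int_commute)
    qed
    also have "\<dots> = (\<Sum>v\<in>U. \<Sum>j\<in>J'. if v \<in> Z j then 1 else 0)" by (rule sum.swap)
    also have "\<dots> \<le> (\<Sum>v\<in>U. L)"
    proof (rule sum_mono)
      fix v
      have "(\<Sum>j\<in>J'. if v \<in> Z j then 1 else 0) = card (J' \<inter> {j. v \<in> Z j})"
        using J'(2) by (simp add: sum.If_cases)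
      also have "\<dots> \<le> card {j \<in> J. v \<in> Z j}" using J J'(1) by (intro card_mono) auto
      finally show "(\<Sum>j\<in>J'. if v \<in> Z j then 1 else 0) \<le> L" using deg le_trans by blast
    qed
    finally have "(\<Sum>j\<in>J'. d j) \<le> card U" using L by simp
    then show "card I' \<le> card (\<Union>i\<in>I'. Z (fst i))" using 1 by (simp add: U_def J'_def image_image)
  qed
  then obtain f where f: "inj_on f I" "\<And>i. i \<in> I \<Longrightarrow> f i \<in> Z (fst i)" by blast
  define Z' where "Z' j = f ` ({j} \<times> {..<d j})" for j
  have sub: "{j} \<times> {..<d j} \<subseteq> I" if "j \<in> J" for j using that by (auto simp: I_def)
  have "Z' j \<subseteq> Z j \<and> card (Z' j) = d j" if "j \<in> J" for j
  proof
    show "Z' j \<subseteq> Z j" using f(2) sub[OF that] by (force simp: Z'_def)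
    show "card (Z' j) = d j"
      using inj_on_subset[OF f(1) sub[OF that]] by (simp add: Z'_def card_image card_cartesian_product)
  qed
  moreover have "disjoint_family_on Z' J"
    unfolding disjoint_family_on_def Z'_def
    using f(1) sub by (force dest: inj_onD)
  ultimately show ?thesis by blast
qed

section \<open>Approximate duality of packings and covers\<close>

text \<open>
  Multiplicative weights. Start with weight 1 everywhere and repeatedly choose a set that carries less
  than the fraction \<open>1 / \<beta>\<close> of the total weight, multiplying the weights on it by \<open>1 + \<epsilon>\<close>; if no such
  set exists, the current weights are a cover. The total weight grows by a factor below
  \<open>1 + \<epsilon> / \<beta>\<close> per step, so by the assumed bound an element that has been chosen \<open>L\<close> times
  within \<open>N\<close> steps alone carries more than \<open>1 / \<beta>\<close> of it and is not chosen again. What matters later is that the cover takes at most \<open>L + 1\<close> different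
  values, a number independent of the size of \<open>V\<close>.
\<close>

lemma packing_or_cover:
  fixes \<K> :: "'v set set" and \<beta> \<epsilon> :: real
  assumes V: "finite V" "\<K> \<subseteq> Pow V" and pos: "\<beta> > 0" "\<epsilon> > 0"
    and bound: "card V / \<beta> * (1 + \<epsilon> / \<beta>) ^ N < (1 + \<epsilon>) ^ L"
  obtains (packing) K where "\<And>i. i < N \<Longrightarrow> K i \<in> \<K>"
      and "\<And>v. v \<in> V \<Longrightarrow> card {i. i < N \<and> v \<in> K i} \<le> L"
    | (cover) c :: "'v \<Rightarrow> nat" where "\<And>v. v \<in> V \<Longrightarrow> c v \<le> L"
      and "\<And>K. K \<in> \<K> \<Longrightarrow> (\<Sum>v\<in>V. (1 + \<epsilon>) ^ c v) \<le> \<beta> * (\<Sum>v\<in>K. (1 + \<epsilon>) ^ c v)"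
proof (cases "\<exists>c. (\<forall>v\<in>V. c v \<le> L) \<and>
    (\<forall>K\<in>\<K>. (\<Sum>v\<in>V. (1 + \<epsilon>) ^ c v) \<le> \<beta> * (\<Sum>v\<in>K. (1 + \<epsilon>) ^ c v))")
  case True
  then show ?thesis using cover by blast
next
  case False
  have "\<exists>K. (\<forall>i<m. K i \<in> \<K>) \<and> (\<forall>v\<in>V. card {i. i < m \<and> v \<in> K i} \<le> L) \<and>
      (\<Sum>v\<in>V. (1 + \<epsilon>) ^ card {i. i < m \<and> v \<in> K i}) \<le> card V * (1 + \<epsilon> / \<beta>) ^ m"
    if "m \<le> N" for m
    using that
  proof (induction m)
    case 0
    show ?case by simp
  next
    case (Suc m)
    then obtain K where K: "\<forall>i<m. K i \<in> \<K>" "\<forall>v\<in>V. card {i. i < m \<and> v \<in> K i} \<le> L"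
      and D: "(\<Sum>v\<in>V. (1 + \<epsilon>) ^ card {i. i < m \<and> v \<in> K i}) \<le> card V * (1 + \<epsilon> / \<beta>) ^ m"
      by auto
    define c where "c v = card {i. i < m \<and> v \<in> K i}" for v
    define W where "W = (\<Sum>v\<in>V. (1 + \<epsilon>) ^ c v)"
    obtain Q where Q: "Q \<in> \<K>" "\<beta> * (\<Sum>v\<in>Q. (1 + \<epsilon>) ^ c v) < W"
      using False K(2) unfolding W_def c_def by (meson not_le)
    define K' where "K' = K(m := Q)"
    define c' where "c' v = card {i. i < Suc m \<and> v \<in> K' i}" for v
    have QV: "Q \<subseteq> V" "finite Q" using Q(1) V finite_subset[of Q V] by auto
    have c': "c' v = c v + (if v \<in> Q then 1 else 0)" for v
    proof -
      have "{i. i < Suc m \<and> v \<in> K' i} = {i. i < m \<and> v \<in> K i} \<union> (if v \<in> Q then {m} else {})"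
        by (auto simp: K'_def less_Suc_eq split: if_splits)
      then show ?thesis by (simp add: c_def c'_def card_insert_if)
    qed
    have W': "(\<Sum>v\<in>V. (1 + \<epsilon>) ^ c' v) = W + \<epsilon> * (\<Sum>v\<in>Q. (1 + \<epsilon>) ^ c v)"
    proof -
      have "(\<Sum>v\<in>V. (1 + \<epsilon>) ^ c' v) = (\<Sum>v\<in>V. (1 + \<epsilon>) ^ c v + (if v \<in> Q then \<epsilon> * (1 + \<epsilon>) ^ c v else 0))"
        by (intro sum.cong) (auto simp: c' algebra_simps)
      also have "\<dots> = W + (\<Sum>v\<in>V \<inter> Q. \<epsilon> * (1 + \<epsilon>) ^ c v)"
        using V(1) by (simp add: sum.distrib W_def sum.If_cases)
      also have "V \<inter> Q = Q" using QV by auto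
      finally show ?thesis by (simp add: sum_distrib_left)
    qed
    have Qle: "(\<Sum>v\<in>Q. (1 + \<epsilon>) ^ c v) \<le> W / \<beta>"
      using Q(2) pos by (simp add: field_simps)
    have "W + \<epsilon> * (\<Sum>v\<in>Q. (1 + \<epsilon>) ^ c v) \<le> W + \<epsilon> * (W / \<beta>)"
      using Qle pos by (intro add_left_mono mult_left_mono) auto
    also have "\<dots> = W * (1 + \<epsilon> / \<beta>)" by (simp add: algebra_simps)
    also have "\<dots> \<le> card V * (1 + \<epsilon> / \<beta>) ^ m * (1 + \<epsilon> / \<beta>)"
      using D pos by (intro mult_right_mono) (auto simp: W_def c_def)
    finally have D': "(\<Sum>v\<in>V. (1 + \<epsilon>) ^ c' v) \<le> card V * (1 + \<epsilon> / \<beta>) ^ Suc m"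
      unfolding W' by (simp add: mult_ac)
    have "c' v \<le> L" if v: "v \<in> V" for v
    proof (rule ccontr)
      assume "\<not> c' v \<le> L"
      then have vQ: "v \<in> Q" and cv: "c v = L"
        using K(2) v by (auto simp: c' c_def split: if_splits)
      have "(1 + \<epsilon>) ^ L \<le> (\<Sum>v\<in>Q. (1 + \<epsilon>) ^ c v)"
        using member_le_sum[OF vQ, of "\<lambda>v. (1 + \<epsilon>) ^ c v"] QV pos cv by simp
      also have "\<dots> \<le> W / \<beta>" by (rule Qle)
      also have "\<dots> \<le> card V * (1 + \<epsilon> / \<beta>) ^ m / \<beta>"
        using D pos by (intro divide_right_mono) (auto simp: W_def c_def)
      also have "\<dots> \<le> card V * (1 + \<epsilon> / \<beta>) ^ N / \<beta>"
        using pos Suc.prems by (intro divide_right_mono mult_left_mono power_increasing) auto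
      finally show False using bound by simp
    qed
    moreover have "\<forall>i<Suc m. K' i \<in> \<K>" using K(1) Q(1) by (auto simp: K'_def less_Suc_eq)
    ultimately show ?case using D' unfolding c'_def by blast
  qed
  from this[of N] show ?thesis using packing by blast
qed

section \<open>A bipartite Ramsey theorem\<close>

lemma pigeonhole_fibre:
  assumes "finite A" "finite B" "f ` A \<subseteq> B" "card B * s < card A"
  shows "\<exists>y\<in>B. s < card {x \<in> A. f x = y}"
proof (rule ccontr)
  assume no: "\<not> ?thesis"
  have "card A = (\<Sum>y\<in>B. card {x \<in> A. f x = y})"
    using sum.group[OF assms(1-3), of "\<lambda>_. 1::nat"] by simp
  also have "\<dots> \<le> (\<Sum>y\<in>B. s)" using no by (intro sum_mono) (meson not_le)
  finally show False using assms(4) by simp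
qed

text \<open>
  Every \<open>y\<close> sees \<open>s\<close> vertices of a fixed bounded set \<open>X0\<close> in one colour. There are boundedly many
  choices of such a colour and such a subset of \<open>X0\<close>, so \<open>s\<close> of the \<open>y\<close> make the same one.
\<close>

lemma bipartite_ramsey:
  fixes C :: "'c set" and s :: nat
  assumes C: "finite C"
  shows "\<exists>R. \<forall>(X :: 'x set) (Y :: 'y set) \<kappa>.
    finite X \<and> finite Y \<and> R \<le> card X \<and> R \<le> card Y \<and> (\<forall>x\<in>X. \<forall>y\<in>Y. \<kappa> x y \<in> C) \<longrightarrow>
    (\<exists>l\<in>C. \<exists>X'\<subseteq>X. \<exists>Y'\<subseteq>Y. card X' = s \<and> card Y' = s \<and> (\<forall>x\<in>X'. \<forall>y\<in>Y'. \<kappa> x y = l))"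
proof -
  define m where "m = card C * s + 1"
  define R where "R = m + (card C * 2 ^ m) * s + 1"
  show ?thesis
  proof (rule exI[of _ R], intro allI impI)
    fix X :: "'x set" and Y :: "'y set" and \<kappa>
    assume asm: "finite X \<and> finite Y \<and> R \<le> card X \<and> R \<le> card Y \<and> (\<forall>x\<in>X. \<forall>y\<in>Y. \<kappa> x y \<in> C)"
    then have fin: "finite X" "finite Y" and card: "R \<le> card X" "R \<le> card Y"
      and col: "\<forall>x\<in>X. \<forall>y\<in>Y. \<kappa> x y \<in> C" by blast+
    obtain X0 where X0: "X0 \<subseteq> X" "card X0 = m" "finite X0"
      using card(1) obtain_subset_with_card_n[of m X] fin(1) by (auto simp: R_def)
    have "\<exists>l X'. l \<in> C \<and> X' \<subseteq> X0 \<and> card X' = s \<and> (\<forall>x\<in>X'. \<kappa> x y = l)" if y: "y \<in> Y" for y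
    proof -
      have "\<exists>l\<in>C. s < card {x \<in> X0. \<kappa> x y = l}"
        by (rule pigeonhole_fibre[OF X0(3) C]) (use col X0 y in \<open>auto simp: m_def\<close>)
      then obtain l where l: "l \<in> C" "s \<le> card {x \<in> X0. \<kappa> x y = l}" by auto
      then obtain X' where "X' \<subseteq> {x \<in> X0. \<kappa> x y = l}" "card X' = s"
        using obtain_subset_with_card_n[of s "{x \<in> X0. \<kappa> x y = l}"] by blast
      then show ?thesis using l(1) by blast
    qed
    then obtain g h where gh: "\<And>y. y \<in> Y \<Longrightarrow> g y \<in> C \<and> h y \<subseteq> X0 \<and> card (h y) = s \<and> (\<forall>x\<in>h y. \<kappa> x y = g y)"
      by metis
    have "\<exists>z\<in>C \<times> Pow X0. s < card {y \<in> Y. (g y, h y) = z}"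
    proof (rule pigeonhole_fibre[OF fin(2)])
      show "card (C \<times> Pow X0) * s < card Y"
        using card(2) X0 by (simp add: card_cartesian_product card_Pow R_def)
      show "(\<lambda>y. (g y, h y)) ` Y \<subseteq> C \<times> Pow X0" using gh by blast
    qed (use C X0 in auto)
    then obtain l X' where lX: "l \<in> C" "X' \<subseteq> X0" "s \<le> card {y \<in> Y. (g y, h y) = (l, X')}"
      by auto
    obtain Y' where Y': "Y' \<subseteq> {y \<in> Y. (g y, h y) = (l, X')}" "card Y' = s" "finite Y'"
      using obtain_subset_with_card_n[OF lX(3)] by blast
    show "\<exists>l\<in>C. \<exists>X'\<subseteq>X. \<exists>Y'\<subseteq>Y. card X' = s \<and> card Y' = s \<and> (\<forall>x\<in>X'. \<forall>y\<in>Y'. \<kappa> x y = l)"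
    proof (cases "Y' = {}")
      case True
      then have "s = 0" using Y' by simp
      then show ?thesis using lX(1) by (intro bexI[of _ l] exI[of _ "{}"]) auto
    next
      case False
      then have "card X' = s" using gh Y'(1) by fastforce
      moreover have "\<forall>x\<in>X'. \<forall>y\<in>Y'. \<kappa> x y = l" using gh Y'(1) by fastforce
      ultimately show ?thesis using lX X0(1) Y'
        by (intro bexI[of _ l] exI[of _ X'] exI[of _ Y'] conjI) auto
    qed
  qed
qed

section \<open>Rounding a fractional cover\<close>

text \<open>
  The values \<open>0\<close>, \<open>1 / (a + b)\<close> and \<open>1 / a\<close> are those taken by the vertices of the polyhedron of
  nonnegative fractional covers \<open>p\<close>, given by \<open>a * p u + b * p v \<ge> 1\<close> and \<open>b * p u + a * p v \<ge> 1\<close> for all edges \<open>uv\<close>.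
  They are numbered 0, 1 and 2 because an edge is covered exactly if the numbers of its ends
  add up to at least 2.
\<close>

definition cost :: "nat \<Rightarrow> nat \<Rightarrow> nat \<Rightarrow> real" where
  "cost a b t = (if t = 0 then 0 else if t = 1 then 1 / (real a + real b) else 1 / real a)"

lemma has_integral_step:
  fixes c d u :: real
  assumes "0 \<le> u"
  shows "((\<lambda>\<theta>. if \<theta> < u then c else d) has_integral c * min 1 u + d * (1 - min 1 u)) {0..1}"
proof -
  define m where "m = min 1 u"
  have m: "0 \<le> m" "m \<le> 1" using assms by (auto simp: m_def)
  have "((\<lambda>\<theta>. if \<theta> < u then c else d) has_integral (m * c)) {0..m}"
    by (rule has_integral_spike_finite[of "{m}" _ _ "\<lambda>_. c"])
       (use has_integral_const_real[of c 0 m] m in \<open>auto simp: m_def\<close>)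
  moreover have "((\<lambda>\<theta>. if \<theta> < u then c else d) has_integral ((1 - m) * d)) {m..1}"
    by (rule has_integral_spike_finite[of "{1}" _ _ "\<lambda>_. d"])
       (use has_integral_const_real[of d m 1] m in \<open>auto simp: m_def min_def split: if_splits\<close>)
  ultimately show ?thesis
    using has_integral_combine[OF m] by (fastforce simp: m_def mult_ac)
qed

text \<open>
  Choose \<open>\<theta>\<close> uniformly in \<open>[0, 1]\<close> and round values below \<open>lo \<theta>\<close> to type 0, values above
  \<open>hi \<theta>\<close> to type 2, and the rest to type 1. The thresholds are matched by
  \<open>b * lo \<theta> + a * hi \<theta> = 1\<close>, so that a vertex of type 0 has only neighbours of type 2. They are linear in
  \<open>\<theta>\<close>, hence a value up to \<open>1 / a\<close> is preserved on average and a larger one does not grow. The slack 1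
  spares the argument that some \<open>\<theta>\<close> is at least as good as the average.
\<close>

lemma threshold_rounding:
  fixes p :: "'v \<Rightarrow> real" and a b :: nat
  assumes U: "finite U" and ab: "1 \<le> a" "1 \<le> b" and p: "\<And>v. v \<in> U \<Longrightarrow> 0 \<le> p v"
  obtains t :: "'v \<Rightarrow> nat" where "\<And>v. t v \<le> 2"
    and "(\<Sum>v\<in>U. cost a b (t v)) \<le> (\<Sum>v\<in>U. p v) + 1"
    and "\<And>u v. 1 \<le> a * p u + b * p v \<Longrightarrow> 1 \<le> b * p u + a * p v \<Longrightarrow> 2 \<le> t u + t v"
proof -
  define lo where "lo \<theta> = (1 - \<theta>) / (real a + real b)" for \<theta> :: real
  define hi where "hi \<theta> = (1 + \<theta> * b / a) / (real a + real b)" for \<theta> :: real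
  define t where "t \<theta> x = (if x < lo \<theta> then 0 else if hi \<theta> < x then 2 else (1::nat))" for \<theta> x :: real
  have pos: "real a > 0" "real b > 0" "real a + real b > 0" using ab by auto
  have int: "\<exists>I. ((\<lambda>\<theta>. cost a b (t \<theta> x)) has_integral I) {0..1} \<and> I \<le> x" if x: "0 \<le> x" for x
  proof (cases "x \<le> 1 / (real a + real b)")
    case True
    define u where "u = 1 - (real a + real b) * x"
    \<comment> \<open>The value is rounded to type 0 exactly for \<open>\<theta> < u\<close>, and to type 1 otherwise.\<close>
    have u: "0 \<le> u" "u \<le> 1" using True x pos by (auto simp: u_def field_simps)
    have "cost a b (t \<theta> x) = (if \<theta> < u then 0 else 1 / (real a + real b))" if "\<theta> \<in> {0..1}" for \<theta>
    proof -
      have "x < lo \<theta> \<longleftrightarrow> \<theta> < u" using pos by (simp add: lo_def u_def field_simps)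
      moreover have "1 / (real a + real b) \<le> hi \<theta>"
        using that pos by (auto simp: hi_def intro!: divide_right_mono)
      ultimately show ?thesis using True by (auto simp: t_def cost_def)
    qed
    then have "((\<lambda>\<theta>. cost a b (t \<theta> x)) has_integral (1 / (real a + real b)) * (1 - u)) {0..1}"
      using has_integral_step[OF u(1), of 0 "1 / (real a + real b)"] u(2)
      by (subst has_integral_cong[where g = "\<lambda>\<theta>. if \<theta> < u then 0 else 1 / (real a + real b)"])
         (auto simp: min_def split: if_splits)
    moreover have "(1 / (real a + real b)) * (1 - u) = x" using pos by (simp add: u_def field_simps)
    ultimately show ?thesis by auto
  next
    case False
    define u where "u = (x * (real a + real b) - 1) * a / b"
    \<comment> \<open>The value is rounded to type 2 exactly for \<open>\<theta> < u\<close>; here \<open>u\<close> may exceed 1.\<close>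
    have "1 < x * (real a + real b)" using False unfolding not_le pos_divide_less_eq[OF pos(3)] .
    then have u: "0 \<le> u"
      unfolding u_def using pos by (intro divide_nonneg_nonneg mult_nonneg_nonneg) simp_all
    have "cost a b (t \<theta> x) = (if \<theta> < u then 1 / a else 1 / (real a + real b))" if "\<theta> \<in> {0..1}" for \<theta>
    proof -
      have "hi \<theta> < x \<longleftrightarrow> 1 + \<theta> * b / a < x * (real a + real b)"
        unfolding hi_def by (rule pos_divide_less_eq[OF pos(3)])
      also have "\<dots> \<longleftrightarrow> \<theta> * b / a < x * (real a + real b) - 1" by linarith
      also have "\<dots> \<longleftrightarrow> \<theta> * b < (x * (real a + real b) - 1) * a"
        by (rule pos_divide_less_eq[OF pos(1)])
      also have "\<dots> \<longleftrightarrow> \<theta> < u"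
        unfolding u_def by (rule pos_less_divide_eq[OF pos(2), symmetric])
      finally have "hi \<theta> < x \<longleftrightarrow> \<theta> < u" .
      moreover have "lo \<theta> \<le> 1 / (real a + real b)"
        using that pos by (auto simp: lo_def intro!: divide_right_mono)
      ultimately show ?thesis using False by (auto simp: t_def cost_def)
    qed
    then have "((\<lambda>\<theta>. cost a b (t \<theta> x)) has_integral
        1 / a * min 1 u + 1 / (real a + real b) * (1 - min 1 u)) {0..1}"
      using has_integral_step[OF u(1), of "1 / a" "1 / (real a + real b)"]
      by (subst has_integral_cong[where g = "\<lambda>\<theta>. if \<theta> < u then 1 / a else 1 / (real a + real b)"]) auto
    moreover have "1 / a * min 1 u + 1 / (real a + real b) * (1 - min 1 u) \<le> x"
    proof -
      have "1 / a * min 1 u + 1 / (real a + real b) * (1 - min 1 u)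
          = 1 / (real a + real b) + (1 / a - 1 / (real a + real b)) * min 1 u"
        by (simp add: diff_divide_distrib algebra_simps)
      also have "\<dots> \<le> 1 / (real a + real b) + (1 / a - 1 / (real a + real b)) * u"
        using pos by (intro add_left_mono mult_left_mono) (auto simp: field_simps)
      also have "\<dots> = x" using pos by (simp add: u_def divide_simps)
      finally show ?thesis .
    qed
    ultimately show ?thesis by blast
  qed
  then obtain I where I: "\<And>x. 0 \<le> x \<Longrightarrow> ((\<lambda>\<theta>. cost a b (t \<theta> x)) has_integral I x) {0..1} \<and> I x \<le> x"
    by metis
  define S where "S = (\<Sum>v\<in>U. p v)"
  have "\<exists>\<theta>\<in>{0..1}. (\<Sum>v\<in>U. cost a b (t \<theta> (p v))) \<le> S + 1"
  proof (rule ccontr)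
    assume no: "\<not> ?thesis"
    have 1: "((\<lambda>\<theta>. \<Sum>v\<in>U. cost a b (t \<theta> (p v))) has_integral (\<Sum>v\<in>U. I (p v))) {0..1}"
      using U I p by (intro has_integral_sum) auto
    have 2: "((\<lambda>\<theta>. S + 1) has_integral (S + 1)) {0..1::real}"
      using has_integral_const_real[of "S + 1" 0 1] by simp
    have "S + 1 \<le> (\<Sum>v\<in>U. I (p v))"
      by (rule has_integral_le[OF 2 1]) (use no in force)
    also have "\<dots> \<le> S" unfolding S_def using I p by (intro sum_mono) auto
    finally show False by simp
  qed
  then obtain \<theta> where \<theta>: "0 \<le> \<theta>" "\<theta> \<le> 1" "(\<Sum>v\<in>U. cost a b (t \<theta> (p v))) \<le> S + 1" by auto
  have high: "hi \<theta> < y" if "x < lo \<theta>" "1 \<le> b * x + a * y" for x y :: real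
  proof -
    have "b * x < b * lo \<theta>" using that(1) pos by simp
    then have "1 - b * lo \<theta> < a * y" using that(2) by linarith
    moreover have "1 - b * lo \<theta> = a * hi \<theta>"
      using pos by (simp add: lo_def hi_def divide_simps) (simp add: algebra_simps)
    ultimately show ?thesis using pos by simp
  qed
  have lohi: "lo \<theta> \<le> hi \<theta>"
  proof -
    have "- \<theta> \<le> \<theta> * b / a" using \<theta>(1) pos by (meson divide_nonneg_pos mult_nonneg_nonneg neg_le_0_iff_le of_nat_0_le_iff order_trans)
    then show ?thesis unfolding lo_def hi_def using pos by (intro divide_right_mono) auto
  qed
  show ?thesis
  proof (rule that[of "\<lambda>v. t \<theta> (p v)"])
    show "(\<Sum>v\<in>U. cost a b (t \<theta> (p v))) \<le> (\<Sum>v\<in>U. p v) + 1" using \<theta>(3) by (simp add: S_def)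
    fix u v assume *: "1 \<le> a * p u + b * p v" "1 \<le> b * p u + a * p v"
    show "2 \<le> t \<theta> (p u) + t \<theta> (p v)"
      using high[of "p u" "p v"] high[of "p v" "p u"] * lohi by (auto simp: t_def)
  qed (simp add: t_def)
qed

section \<open>Intersecting families of colour sets\<close>

text \<open>
  The three terms are the reciprocals of the densities attained by the colourings behind
  \<open>Rt_upper_bounds\<close>, so the maximum belongs to the best of these colourings.
\<close>

definition inverse_density :: "real \<Rightarrow> real \<Rightarrow> real" where
  "inverse_density a b = max (4 * a + b) (max ((5 * a + 3 * b) / 2) (5 * (a + b) / 3))"

lemma le_inverse_density:
  "4 * a + b \<le> inverse_density a b" "(5 * a + 3 * b) / 2 \<le> inverse_density a b"
  "5 * (a + b) / 3 \<le> inverse_density a b"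
  unfolding inverse_density_def
  by (meson max.cobounded1 max.cobounded2 order_trans)+

text \<open>
  The weights \<open>y\<close> form a dual solution of the linear program that maximises the number of vertices for
  a given budget per colour. An intersecting family on four points has one of three forms: it
  contains a singleton, which then lies in every member; it contains the three edges of a triangle, and
  then every member has two points of the triangle; or all its pairs share a point \<open>m\<close>, while the
  other members have at least three points.
\<close>

lemma intersecting_family_weights:
  fixes F :: "'c set set" and a b :: real
  assumes C: "card C = 4" and ab: "0 < a" "a \<le> b"
    and F: "\<And>S. S \<in> F \<Longrightarrow> S \<subseteq> C" and int: "\<And>S T. S \<in> F \<Longrightarrow> T \<in> F \<Longrightarrow> S \<inter> T \<noteq> {}"
  obtains y where "\<And>l. l \<in> C \<Longrightarrow> a \<le> y l" and "(\<Sum>l\<in>C. y l) \<le> inverse_density a b"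
    and "\<And>S. S \<in> F \<Longrightarrow> a + b \<le> (\<Sum>l\<in>S. y l)"
proof -
  have finC: "finite C" using C card.infinite by fastforce
  have finS: "finite S" if "S \<in> F" for S using F[OF that] finC finite_subset by auto
  have subset_sum: "sum y T \<le> sum y S" if "S \<in> F" "T \<subseteq> S" "\<And>l. l \<in> C \<Longrightarrow> a \<le> y l" for S T y
  proof (rule sum_mono2[OF finS[OF that(1)] that(2)])
    fix l assume "l \<in> S - T"
    then have "a \<le> y l" using that(3) F[OF that(1)] by auto
    then show "0 \<le> y l" using ab by simp
  qed
  have two_valued: "(\<Sum>k\<in>S. if k = l then p else q) = p + real (card S - 1) * q"
    if "finite S" "l \<in> S" for S :: "'c set" and l p q
    using that by (simp add: sum.remove[of S l] card_Diff_singleton)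
  consider (single) l where "{l} \<in> F"
    | (triangle) i j k where "{i, j} \<in> F" "{i, k} \<in> F" "{j, k} \<in> F" "i \<noteq> j" "i \<noteq> k" "j \<noteq> k"
    | (star) m where "m \<in> C" "\<And>S. S \<in> F \<Longrightarrow> card S = 2 \<Longrightarrow> m \<in> S" "\<And>l. {l} \<notin> F"
  proof (cases "\<exists>l. {l} \<in> F")
    case True
    then obtain l where "{l} \<in> F" ..
    then show ?thesis by (rule single)
  next
    case ns: False
    show ?thesis
    proof (cases "\<exists>P\<in>F. card P = 2")
      case False
      moreover obtain m where "m \<in> C" using C by fastforce
      ultimately show ?thesis using ns by (intro star[of m]) auto
    next
      case True
      then obtain i j where ij: "{i, j} \<in> F" "i \<noteq> j" by (metis card_2_iff)
      show ?thesis
      proof (cases "(\<forall>S\<in>F. card S = 2 \<longrightarrow> i \<in> S) \<or> (\<forall>S\<in>F. card S = 2 \<longrightarrow> j \<in> S)")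
        case True
        then obtain m where "m \<in> {i, j}" "\<forall>S\<in>F. card S = 2 \<longrightarrow> m \<in> S" by blast
        then show ?thesis using ns F[OF ij(1)] by (intro star[of m]) auto
      next
        case False
        then obtain P Q where P: "P \<in> F" "card P = 2" "i \<notin> P" and Q: "Q \<in> F" "card Q = 2" "j \<notin> Q"
          by blast
        have "j \<in> P" using int[OF ij(1) P(1)] P(3) by auto
        then obtain k where k: "P = {j, k}" "j \<noteq> k"
          using P(2) unfolding card_2_iff by blast
        have "i \<in> Q" using int[OF ij(1) Q(1)] Q(3) by auto
        then obtain k' where k': "Q = {i, k'}" "i \<noteq> k'"
          using Q(2) unfolding card_2_iff by blast
        have "k = k'" using int[OF P(1) Q(1)] k k' ij(2) P(3) Q(3) by auto
        then show ?thesis using ij P(1,3) Q(1) k k' by (intro triangle[of i j k]) auto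
      qed
    qed
  qed
  then show ?thesis
  proof cases
    case single
    let ?y = "\<lambda>k. if k = l then a + b else a"
    have lS: "l \<in> S" if "S \<in> F" for S using int[OF single that] by auto
    have "l \<in> C" using F single by auto
    show ?thesis
    proof (rule that[of ?y])
      show "(\<Sum>k\<in>C. ?y k) \<le> inverse_density a b"
        using two_valued[OF finC \<open>l \<in> C\<close>, of "a + b" a] C le_inverse_density(1)[of a b] by simp
      show "a + b \<le> (\<Sum>k\<in>S. ?y k)" if "S \<in> F" for S
        using subset_sum[OF that, of "{l}" ?y] lS[OF that] ab by simp
    qed (use ab in auto)
  next
    case triangle
    let ?T = "{i, j, k}"
    let ?y = "\<lambda>x. if x \<in> ?T then (a + b) / 2 else a"
    have T: "?T \<subseteq> C" "card ?T = 3" using F triangle by auto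
    have y: "a \<le> ?y l" for l using ab by auto
    show ?thesis
    proof (rule that[of ?y])
      have "card (C - ?T) = 1" using T C by (simp add: card_Diff_subset)
      moreover have "(\<Sum>x\<in>C. ?y x) = (\<Sum>x\<in>?T. ?y x) + (\<Sum>x\<in>C - ?T. ?y x)"
        unfolding sum.subset_diff[OF T(1) finC] by (rule add.commute)
      moreover have "(\<Sum>x\<in>C - ?T. ?y x) = (\<Sum>x\<in>C - ?T. a)" by (intro sum.cong) auto
      moreover have "(\<Sum>x\<in>?T. ?y x) = (\<Sum>x\<in>?T. (a + b) / 2)" by (intro sum.cong) auto
      ultimately have "(\<Sum>x\<in>C. ?y x) = 3 * ((a + b) / 2) + a"
        using T(2) by (simp del: sum.insert)
      then show "(\<Sum>x\<in>C. ?y x) \<le> inverse_density a b"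
        using le_inverse_density(2)[of a b] by (simp add: field_simps)
      fix S assume S: "S \<in> F"
      have "{i, j} \<subseteq> S \<or> {i, k} \<subseteq> S \<or> {j, k} \<subseteq> S"
        using int[OF S triangle(1)] int[OF S triangle(2)] int[OF S triangle(3)] by auto
      then obtain P where "P \<in> {{i, j}, {i, k}, {j, k}}" "P \<subseteq> S" by blast
      then have P: "P \<subseteq> S" "P \<subseteq> ?T" "card P = 2" using triangle(4-6) by auto
      have "a + b = (\<Sum>x\<in>P. (a + b) / 2)" using P(3) by simp
      also have "\<dots> = (\<Sum>x\<in>P. ?y x)" using P(2) by (intro sum.cong) auto
      also have "\<dots> \<le> (\<Sum>x\<in>S. ?y x)" by (rule subset_sum[OF S P(1)]) (rule y)
      finally show "a + b \<le> (\<Sum>x\<in>S. ?y x)" .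
    qed (rule y)
  next
    case star
    \<comment> \<open>A pair needs \<open>A + (a + b - A)\<close>, a triple avoiding \<open>m\<close> needs \<open>3 * A \<ge> a + b\<close>.\<close>
    define A where "A = max a ((a + b) / 3)"
    let ?y = "\<lambda>k. if k = m then a + b - A else A"
    have A: "a \<le> A" "2 * A \<le> a + b" "a + b \<le> 3 * A" using ab by (auto simp: A_def max_def field_simps)
    have y: "A \<le> ?y l" for l using A by auto
    show ?thesis
    proof (rule that[of ?y])
      show "(\<Sum>k\<in>C. ?y k) \<le> inverse_density a b"
        using two_valued[OF finC star(1), of "a + b - A" A] C ab
          le_inverse_density(1)[of a b] le_inverse_density(3)[of a b]
        by (cases "a \<le> (a + b) / 3") (simp_all add: A_def max_def field_simps)
      show "a \<le> ?y l" for l using A y[of l] by linarith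
      fix S assume S: "S \<in> F"
      have "card S \<noteq> 0" using int[OF S S] finS[OF S] by auto
      moreover have "card S \<noteq> 1" using star(3) S by (metis card_1_singletonE)
      ultimately consider "card S = 2" | "3 \<le> card S" by linarith
      then show "a + b \<le> (\<Sum>k\<in>S. ?y k)"
      proof cases
        case 1
        then show ?thesis using two_valued[OF finS[OF S] star(2)[OF S 1], of "a + b - A" A] by simp
      next
        case 2
        have "a + b \<le> 3 * A" by (rule A)
        also have "\<dots> \<le> card S * A" using 2 A ab by (intro mult_right_mono) auto
        also have "\<dots> = (\<Sum>k\<in>S. A)" by simp
        also have "\<dots> \<le> (\<Sum>k\<in>S. ?y k)" using y by (intro sum_mono)
        finally show ?thesis .
      qed
    qed
  qed
qed

section \<open>Monochromatic copies and packing numbers\<close>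

definition biclique :: "'v set \<Rightarrow> 'v set \<Rightarrow> 'v ugraph" where
  "biclique X Y = (X \<union> Y, {{x, y} | x y. x \<in> X \<and> y \<in> Y})"

lemma copies_complete_bipartite:
  assumes "1 \<le> a" "1 \<le> b"
  shows "C \<in> copies (complete_bipartite a b) (complete_graph n) \<longleftrightarrow>
    (\<exists>X Y. X \<union> Y \<subseteq> {1..n} \<and> X \<inter> Y = {} \<and> card X = a \<and> card Y = b \<and> C = biclique X Y)"
    (is "?L \<longleftrightarrow> ?R")
proof
  assume ?L
  then obtain f where V: "vertices C \<subseteq> {1..n}"
    and f: "bij_betw f ({1..a} <+> {1..b}) (vertices C)"
    and E: "edges C = (\<lambda>e. f ` e) ` {{Inl i, Inr j} | i j. i \<in> {1..a} \<and> j \<in> {1..b}}"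
    by (auto simp: copies_def isomorphic_def complete_bipartite_def complete_graph_def)
  define X where "X = f ` Inl ` {1..a}"
  define Y where "Y = f ` Inr ` {1..b}"
  have inj: "inj_on f ({1..a} <+> {1..b})" and im: "f ` ({1..a} <+> {1..b}) = vertices C"
    using f by (auto simp: bij_betw_def)
  have XY: "X \<union> Y = vertices C" using im by (auto simp: X_def Y_def Plus_def image_Un)
  have inj1: "inj_on (f \<circ> Inl) {1..a}" and inj2: "inj_on (f \<circ> Inr) {1..b}"
    using inj by (auto simp: inj_on_def)
  have "card X = a" "card Y = b"
    using card_image[OF inj1] card_image[OF inj2] by (simp_all add: X_def Y_def image_comp)
  moreover have "X \<inter> Y = {}"
  proof -
    have "f (Inl i) \<noteq> f (Inr j)" if "i \<in> {1..a}" "j \<in> {1..b}" for i j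
      using inj_onD[OF inj, of "Inl i" "Inr j"] that by blast
    then show ?thesis unfolding X_def Y_def by blast
  qed
  moreover have "edges C = {{x, y} | x y. x \<in> X \<and> y \<in> Y}"
  proof -
    have "e \<in> edges C \<longleftrightarrow> (\<exists>i\<in>{1..a}. \<exists>j\<in>{1..b}. e = {f (Inl i), f (Inr j)})" for e
    proof
      assume "e \<in> edges C"
      then obtain i j where "i \<in> {1..a}" "j \<in> {1..b}" "e = f ` {Inl i, Inr j}" unfolding E by blast
      then show "\<exists>i\<in>{1..a}. \<exists>j\<in>{1..b}. e = {f (Inl i), f (Inr j)}"
        by (intro bexI[of _ i] bexI[of _ j]) simp_all
    next
      assume "\<exists>i\<in>{1..a}. \<exists>j\<in>{1..b}. e = {f (Inl i), f (Inr j)}"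
      then obtain i j where "i \<in> {1..a}" "j \<in> {1..b}" "e = f ` {Inl i, Inr j}" by auto
      then show "e \<in> edges C" unfolding E by blast
    qed
    moreover have "e \<in> {{x, y} | x y. x \<in> X \<and> y \<in> Y} \<longleftrightarrow> (\<exists>x\<in>X. \<exists>y\<in>Y. e = {x, y})" for e
      by blast
    ultimately show ?thesis by (intro set_eqI) (simp add: X_def Y_def)
  qed
  ultimately show ?R using V XY
    by (intro exI[of _ X] exI[of _ Y]) (simp add: biclique_def prod_eq_iff)
next
  assume ?R
  then obtain X Y where XY: "X \<union> Y \<subseteq> {1..n}" "X \<inter> Y = {}" "card X = a" "card Y = b"
    and C: "C = biclique X Y" by blast
  have fin: "finite X" "finite Y" using XY(1) finite_subset by auto
  obtain g where g: "bij_betw g {1..a} X"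
    using ex_bij_betw_nat_finite_1[OF fin(1)] XY(3) by blast
  obtain h where h: "bij_betw h {1..b} Y"
    using ex_bij_betw_nat_finite_1[OF fin(2)] XY(4) by blast
  define f where "f = case_sum g h"
  have gX: "g ` {1..a} = X" and hY: "h ` {1..b} = Y" using g h by (auto simp: bij_betw_def)
  have "bij_betw f ({1..a} <+> {1..b}) (X \<union> Y)"
    unfolding bij_betw_def
  proof
    show "inj_on f ({1..a} <+> {1..b})"
    proof (rule inj_onI)
      fix p q assume pq: "p \<in> {1..a} <+> {1..b}" "q \<in> {1..a} <+> {1..b}" "f p = f q"
      have "g i \<noteq> h j" if "i \<in> {1..a}" "j \<in> {1..b}" for i j
        using gX hY XY(2) that by blast
      moreover have "inj_on g {1..a}" "inj_on h {1..b}" using g h by (auto simp: bij_betw_def)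
      ultimately show "p = q" using pq
        by (cases p; cases q) (auto simp: f_def dest: inj_onD, metis)
    qed
    show "f ` ({1..a} <+> {1..b}) = X \<union> Y"
      using gX hY by (auto simp: Plus_def image_Un f_def image_image)
  qed
  moreover have "{{x, y} | x y. x \<in> X \<and> y \<in> Y} =
      (\<lambda>e. f ` e) ` {{Inl i, Inr j} | i j. i \<in> {1..a} \<and> j \<in> {1..b}}" (is "?E = ?F")
  proof
    show "?F \<subseteq> ?E"
    proof
      fix e assume "e \<in> ?F"
      then obtain i j where "i \<in> {1..a}" "j \<in> {1..b}" "e = f ` {Inl i, Inr j}" by blast
      then have "g i \<in> X" "h j \<in> Y" "e = {g i, h j}" using gX hY by (auto simp: f_def)
      then show "e \<in> ?E" by blast
    qed
    show "?E \<subseteq> ?F"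
    proof
      fix e assume "e \<in> ?E"
      then obtain i j where ij: "i \<in> {1..a}" "j \<in> {1..b}" "e = {g i, h j}" using gX hY by blast
      then have "e = f ` {Inl i, Inr j}" by (simp add: f_def)
      then show "e \<in> ?F" using ij by blast
    qed
  qed
  moreover have "?E \<subseteq> [{1..n}]\<^bsup>2\<^esup>" using XY by (fastforce simp: nsets_2_eq)
  ultimately show ?L using XY(1)
    by (auto simp: C biclique_def copies_def isomorphic_def complete_bipartite_def complete_graph_def)
qed

lemma finite_mono_copies:
  assumes "finite (vertices G)" "finite (edges G)"
  shows "finite (mono_copies H G \<kappa> l)"
proof (rule finite_subset)
  show "mono_copies H G \<kappa> l \<subseteq> Pow (vertices G) \<times> Pow (edges G)"
    by (auto simp: mono_copies_def copies_def mem_Times_iff)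
qed (use assms in auto)

lemma finite_packing_sizes:
  assumes "finite (vertices G)" "finite (edges G)"
  shows "finite {card F | F. F \<subseteq> mono_copies H G \<kappa> l \<and> vertex_disjoint F}"
  using finite_mono_copies[OF assms, of H \<kappa> l] by (intro finite_image_set) (auto simp flip: Pow_iff)

lemma mono_packing_number_ge:
  assumes "finite (vertices G)" "finite (edges G)" "F \<subseteq> mono_copies H G \<kappa> l" "vertex_disjoint F"
  shows "card F \<le> mono_packing_number H G \<kappa> l"
  unfolding mono_packing_number_def using assms(3,4)
  by (intro Max_ge[OF finite_packing_sizes[OF assms(1,2)]]) blast

lemma mono_packing_number_le:
  assumes "finite (vertices G)" "finite (edges G)"
    and "\<And>F. F \<subseteq> mono_copies H G \<kappa> l \<Longrightarrow> vertex_disjoint F \<Longrightarrow> real (card F) \<le> x"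
  shows "real (mono_packing_number H G \<kappa> l) \<le> x"
proof -
  let ?S = "{card F | F. F \<subseteq> mono_copies H G \<kappa> l \<and> vertex_disjoint F}"
  have "?S \<noteq> {}" by (auto intro!: exI[of _ "{}"] simp: vertex_disjoint_def)
  then have "Max ?S \<in> ?S" using finite_packing_sizes[OF assms(1,2)] by (intro Max_in)
  then show ?thesis using assms(3) unfolding mono_packing_number_def by force
qed

lemma finite_complete_graph:
  "finite (vertices (complete_graph n))" "finite (edges (complete_graph n))"
  by (simp_all add: complete_graph_def finite_imp_finite_nsets)

lemma Rt_le:
  assumes \<kappa>: "\<kappa> \<in> edge_colourings r (complete_graph n)" and r: "1 \<le> r"
    and le: "\<And>l. l \<in> {1..r} \<Longrightarrow> real (mono_packing_number H (complete_graph n) \<kappa> l) \<le> x"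
  shows "real (Rt r H (complete_graph n)) \<le> x"
proof -
  have "finite (edge_colourings r (complete_graph n))"
    unfolding edge_colourings_def using finite_complete_graph by (intro finite_PiE) auto
  then have "Rt r H (complete_graph n) \<le> nu r H (complete_graph n) \<kappa>"
    unfolding Rt_def using \<kappa> by (intro Min_le) auto
  moreover have "nu r H (complete_graph n) \<kappa> \<in> mono_packing_number H (complete_graph n) \<kappa> ` {1..r}"
    unfolding nu_def using r by (intro Max_in) auto
  ultimately show ?thesis using le by fastforce
qed

lemma Rt_ge:
  assumes r: "1 \<le> r"
    and ge: "\<And>\<kappa>. \<kappa> \<in> edge_colourings r (complete_graph n) \<Longrightarrow>
      \<exists>l\<in>{1..r}. k \<le> mono_packing_number H (complete_graph n) \<kappa> l"
  shows "k \<le> Rt r H (complete_graph n)"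
proof -
  let ?E = "edge_colourings r (complete_graph n)"
  have "finite ?E"
    unfolding edge_colourings_def using finite_complete_graph by (intro finite_PiE) auto
  moreover have "?E \<noteq> {}" using r by (auto simp: edge_colourings_def PiE_eq_empty_iff)
  ultimately have "Rt r H (complete_graph n) \<in> nu r H (complete_graph n) ` ?E"
    unfolding Rt_def by (intro Min_in) auto
  then obtain \<kappa> where \<kappa>: "\<kappa> \<in> ?E" "Rt r H (complete_graph n) = nu r H (complete_graph n) \<kappa>" by auto
  obtain l where l: "l \<in> {1..r}" "k \<le> mono_packing_number H (complete_graph n) \<kappa> l"
    using ge[OF \<kappa>(1)] by blast
  have "mono_packing_number H (complete_graph n) \<kappa> l \<le> nu r H (complete_graph n) \<kappa>"
    unfolding nu_def using l(1) by (intro Max_ge) auto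
  then show ?thesis using l(2) \<kappa>(2) by simp
qed

lemma mono_copies_complete_bipartite:
  assumes "1 \<le> a" "1 \<le> b"
  shows "C \<in> mono_copies (complete_bipartite a b) (complete_graph n) \<kappa> l \<longleftrightarrow>
    (\<exists>X Y. X \<union> Y \<subseteq> {1..n} \<and> X \<inter> Y = {} \<and> card X = a \<and> card Y = b \<and>
      (\<forall>x\<in>X. \<forall>y\<in>Y. \<kappa> {x, y} = l) \<and> C = biclique X Y)"
proof -
  have "(\<forall>e\<in>edges (biclique X Y). \<kappa> e = l) \<longleftrightarrow> (\<forall>x\<in>X. \<forall>y\<in>Y. \<kappa> {x, y} = l)" for X Y
    by (auto simp: biclique_def)
  then have "C = biclique X Y \<Longrightarrow>
      (\<forall>e\<in>edges C. \<kappa> e = l) \<longleftrightarrow> (\<forall>x\<in>X. \<forall>y\<in>Y. \<kappa> {x, y} = l)" for X Y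
    by simp
  then show ?thesis
    unfolding mono_copies_def mem_Collect_eq copies_complete_bipartite[OF assms]
    by (intro iffI; elim exE conjE) (simp_all, metis+)
qed

text \<open>
  A copy in colour \<open>l\<close> costs at least 1. If one of its vertices has type 0, the opposite side consists
  of at least \<open>a\<close> vertices of type 2, each of cost \<open>1 / a\<close>. Otherwise all \<open>a + b\<close> vertices cost at least
  \<open>1 / (a + b)\<close>.
\<close>

lemma packing_le_cost:
  fixes t :: "nat \<Rightarrow> nat"
  assumes ab: "1 \<le> a" "a \<le> b"
    and t: "\<And>u v. \<lbrakk>u \<in> {1..n}; v \<in> {1..n}; u \<noteq> v; \<kappa> {u, v} = l\<rbrakk> \<Longrightarrow> 2 \<le> t u + t v"
  shows "real (mono_packing_number (complete_bipartite a b) (complete_graph n) \<kappa> l)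
    \<le> (\<Sum>v=1..n. cost a b (t v))"
proof (rule mono_packing_number_le[OF finite_complete_graph])
  let ?M = "mono_copies (complete_bipartite a b) (complete_graph n) \<kappa> l"
  have pos: "real a > 0" "real b > 0" "real a \<le> real b" using ab by auto
  have cost0: "0 \<le> cost a b k" for k using pos by (auto simp: cost_def)
  have cost1: "1 / (real a + real b) \<le> cost a b k" if "k \<noteq> 0" for k
    using pos that by (auto simp: cost_def intro!: divide_left_mono)
  have one: "vertices C \<subseteq> {1..n} \<and> 1 \<le> (\<Sum>v\<in>vertices C. cost a b (t v))" if "C \<in> ?M" for C
  proof -
    have b1: "1 \<le> b" using ab by simp
    from mono_copies_complete_bipartite[OF ab(1) b1, THEN iffD1, OF that]
    obtain X Y where XY: "X \<union> Y \<subseteq> {1..n}" "X \<inter> Y = {}" "card X = a" "card Y = b"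
      and col: "\<forall>x\<in>X. \<forall>y\<in>Y. \<kappa> {x, y} = l" and "C = biclique X Y"
      by (elim exE conjE)
    then have C: "vertices C = X \<union> Y" by (simp add: biclique_def)
    have fin: "finite X" "finite Y"
      using XY(1) finite_subset[of X "{1..n}"] finite_subset[of Y "{1..n}"] by simp_all
    have two: "2 \<le> t x + t y" if xy: "x \<in> X" "y \<in> Y" for x y
    proof (rule t)
      show "x \<in> {1..n}" "y \<in> {1..n}" using XY(1) xy by blast+
      show "x \<noteq> y" using XY(2) xy by blast
      show "\<kappa> {x, y} = l" using col xy by simp
    qed
    have side: "1 \<le> (\<Sum>v\<in>X \<union> Y. cost a b (t v))" if S: "S \<subseteq> X \<union> Y" "a \<le> card S"
      "\<And>v. v \<in> S \<Longrightarrow> 2 \<le> t v" for S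
    proof -
      have "1 \<le> card S * (1 / real a)" using S(2) pos by simp
      also have "\<dots> = (\<Sum>v\<in>S. 1 / real a)" by simp
      also have "\<dots> \<le> (\<Sum>v\<in>S. cost a b (t v))"
      proof (rule sum_mono)
        fix v assume "v \<in> S"
        then show "1 / real a \<le> cost a b (t v)" using S(3)[of v] by (simp add: cost_def)
      qed
      also have "\<dots> \<le> (\<Sum>v\<in>X \<union> Y. cost a b (t v))"
        using fin S(1) cost0 by (intro sum_mono2) auto
      finally show ?thesis .
    qed
    have "1 \<le> (\<Sum>v\<in>X \<union> Y. cost a b (t v))"
    proof (cases "\<exists>z\<in>X \<union> Y. t z = 0")
      case True
      then obtain z where z: "z \<in> X \<union> Y" "t z = 0" by blast
      then consider "z \<in> X" | "z \<in> Y" by blast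
      then show ?thesis
      proof cases
        case 1
        then show ?thesis using side[of Y] two[of z] z(2) XY(4) ab(2) by simp
      next
        case 2
        then show ?thesis using side[of X] two[of _ z] z(2) XY(3) by simp
      qed
    next
      case False
      have "1 = (\<Sum>v\<in>X \<union> Y. 1 / (real a + real b))"
        using fin XY pos by (simp add: card_Un_disjoint)
      also have "\<dots> \<le> (\<Sum>v\<in>X \<union> Y. cost a b (t v))" using False cost1 by (intro sum_mono) auto
      finally show ?thesis .
    qed
    then show ?thesis using XY(1) C by simp
  qed
  fix F assume F: "F \<subseteq> ?M" "vertex_disjoint F"
  have finF: "finite F" using F(1) finite_mono_copies[OF finite_complete_graph] finite_subset by blast
  have "real (card F) = (\<Sum>C\<in>F. 1)" by simp
  also have "\<dots> \<le> (\<Sum>C\<in>F. \<Sum>v\<in>vertices C. cost a b (t v))"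
    using one F(1) by (intro sum_mono) auto
  also have "\<dots> = (\<Sum>v\<in>(\<Union>C\<in>F. vertices C). cost a b (t v))"
  proof (rule sum.UNION_disjoint[symmetric, OF finF])
    show "\<forall>C\<in>F. finite (vertices C)" using one F(1) by (meson finite_atLeastAtMost finite_subset subsetD)
    show "\<forall>C\<in>F. \<forall>D\<in>F. C \<noteq> D \<longrightarrow> vertices C \<inter> vertices D = {}"
      using F(2) by (auto simp: vertex_disjoint_def pairwise_def disjnt_def)
  qed
  also have "\<dots> \<le> (\<Sum>v=1..n. cost a b (t v))"
    using one F(1) cost0 by (intro sum_mono2) auto
  finally show "real (card F) \<le> (\<Sum>v=1..n. cost a b (t v))" .
qed

lemma packing_ge_of_bicliques:
  fixes X Y :: "nat \<Rightarrow> nat set"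
  assumes ab: "1 \<le> a" "1 \<le> b" and L: "0 < L"
    and XY: "\<And>i. i < N \<Longrightarrow> X i \<union> Y i \<subseteq> {1..n} \<and> X i \<inter> Y i = {} \<and>
        card (X i) = a * L \<and> card (Y i) = b * L \<and> (\<forall>x\<in>X i. \<forall>y\<in>Y i. \<kappa> {x, y} = l)"
    and deg: "\<And>v. v \<in> {1..n} \<Longrightarrow> card {i. i < N \<and> v \<in> X i \<union> Y i} \<le> L"
  shows "N \<le> mono_packing_number (complete_bipartite a b) (complete_graph n) \<kappa> l"
proof -
  define J where "J = {..<N} \<times> (UNIV :: bool set)"
  define Z where "Z = (\<lambda>(i, s). if s then X i else Y i)"
  define d where "d = (\<lambda>(i :: nat, s). if s then a else b)"
  have "\<exists>Z'. (\<forall>j\<in>J. Z' j \<subseteq> Z j \<and> card (Z' j) = d j) \<and> disjoint_family_on Z' J"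
  proof (rule disjoint_selection[OF _ L])
    show "finite J" by (simp add: J_def)
    show "finite (Z j) \<and> card (Z j) = d j * L" if "j \<in> J" for j
      using that XY finite_subset[of _ "{1..n}"] by (fastforce simp: J_def Z_def d_def)
    fix v
    let ?D = "{j \<in> J. v \<in> Z j}"
    show "card ?D \<le> L"
    proof (cases "v \<in> {1..n}")
      case True
      have "inj_on fst ?D" using XY by (fastforce simp: inj_on_def J_def Z_def split: if_splits)
      moreover have "fst ` ?D \<subseteq> {i. i < N \<and> v \<in> X i \<union> Y i}"
        by (auto simp: J_def Z_def split: if_splits)
      ultimately have "card ?D \<le> card {i. i < N \<and> v \<in> X i \<union> Y i}"
        by (intro card_inj_on_le[of fst]) auto
      then show ?thesis using deg[OF True] by simp
    next
      case False
      then have "?D = {}" using XY by (fastforce simp: J_def Z_def split: if_splits)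
      then show ?thesis by (metis card.empty le0)
    qed
  qed
  then obtain Z' where Z': "\<And>j. j \<in> J \<Longrightarrow> Z' j \<subseteq> Z j \<and> card (Z' j) = d j"
    and disj: "disjoint_family_on Z' J" by blast
  define C where "C i = biclique (Z' (i, True)) (Z' (i, False))" for i
  have sub: "Z' (i, True) \<subseteq> X i" "Z' (i, False) \<subseteq> Y i" "card (Z' (i, True)) = a" "card (Z' (i, False)) = b"
    if "i < N" for i
    using Z'[of "(i, True)"] Z'[of "(i, False)"] that by (auto simp: J_def Z_def d_def)
  have vC: "vertices (C i) = Z' (i, True) \<union> Z' (i, False)" for i by (simp add: C_def biclique_def)
  have dC: "vertices (C i) \<inter> vertices (C j) = {}" if "i < N" "j < N" "i \<noteq> j" for i j
    using disj that unfolding disjoint_family_on_def vC J_def by blast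
  have neC: "vertices (C i) \<noteq> {}" if "i < N" for i
    using sub[OF that] ab by (auto simp: vC)
  have "inj_on C {..<N}"
    using dC neC by (intro inj_onI) (metis Int_absorb lessThan_iff)
  then have "N = card (C ` {..<N})" by (simp add: card_image)
  also have "\<dots> \<le> mono_packing_number (complete_bipartite a b) (complete_graph n) \<kappa> l"
  proof (rule mono_packing_number_ge[OF finite_complete_graph])
    show "vertex_disjoint (C ` {..<N})"
      using dC by (auto simp: vertex_disjoint_def pairwise_def disjnt_def)
    show "C ` {..<N} \<subseteq> mono_copies (complete_bipartite a b) (complete_graph n) \<kappa> l"
    proof
      fix D assume "D \<in> C ` {..<N}"
      then obtain i where i: "i < N" "D = C i" by auto
      show "D \<in> mono_copies (complete_bipartite a b) (complete_graph n) \<kappa> l"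
        unfolding mono_copies_complete_bipartite[OF ab]
      proof (rule exI[of _ "Z' (i, True)"], rule exI[of _ "Z' (i, False)"], intro conjI)
        show "Z' (i, True) \<union> Z' (i, False) \<subseteq> {1..n}" "Z' (i, True) \<inter> Z' (i, False) = {}"
          "\<forall>x\<in>Z' (i, True). \<forall>y\<in>Z' (i, False). \<kappa> {x, y} = l"
          using sub(1,2)[OF i(1)] XY[OF i(1)] by blast+
        show "D = biclique (Z' (i, True)) (Z' (i, False))" using i(2) by (simp add: C_def)
      qed (use sub(3,4)[OF i(1)] in auto)
    qed
  qed
  finally show ?thesis .
qed

section \<open>Colourings with small packing numbers\<close>

text \<open>
  Cut \<open>[0, n]\<close> into consecutive intervals of lengths \<open>p i * n\<close>.
\<close>

lemma proportional_partition:
  fixes p :: "nat \<Rightarrow> real"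
  assumes p: "\<And>i. i < k \<Longrightarrow> 0 \<le> p i" and sum: "(\<Sum>i<k. p i) = 1"
  obtains f :: "nat \<Rightarrow> nat" where "\<And>v. v \<in> {1..n} \<Longrightarrow> f v < k"
    and "\<And>i. i < k \<Longrightarrow> real (card {v \<in> {1..n}. f v = i}) \<le> p i * n + 1"
proof -
  \<comment> \<open>Vertex \<open>v\<close> goes to the interval \<open>(P i, P (Suc i)]\<close> that contains it.\<close>
  define P where "P i = (\<Sum>j<i. p j) * n" for i
  define f where "f v = (LEAST i. real v \<le> P (Suc i))" for v :: nat
  have k: "k > 0" using sum by (cases k) auto
  have Pk: "P k = n" using sum by (simp add: P_def)
  have f: "f v \<le> k - 1 \<and> real v \<le> P (Suc (f v))" if "v \<in> {1..n}" for v
  proof -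
    have *: "real v \<le> P (Suc (k - 1))" using that Pk k by simp
    show ?thesis unfolding f_def
      using Least_le[of "\<lambda>i. real v \<le> P (Suc i)", OF *] LeastI[of "\<lambda>i. real v \<le> P (Suc i)", OF *] by simp
  qed
  have f': "P (f v) < real v" if "v \<in> {1..n}" for v
  proof (cases "f v")
    case 0
    then show ?thesis using that by (simp add: P_def)
  next
    case (Suc i)
    then have "\<not> real v \<le> P (Suc i)"
      using not_less_Least[of i "\<lambda>i. real v \<le> P (Suc i)"] by (simp add: f_def)
    then show ?thesis using Suc by simp
  qed
  show ?thesis
  proof (rule that[of f])
    show "f v < k" if "v \<in> {1..n}" for v using f[OF that] k by linarith
    fix i assume i: "i < k"
    have Pi: "0 \<le> P i" using p i by (auto simp: P_def intro!: mult_nonneg_nonneg sum_nonneg)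
    have PS: "P (Suc i) = P i + p i * n" by (simp add: P_def algebra_simps)
    have pin: "0 \<le> p i * n" using p[OF i] by simp
    have "{v \<in> {1..n}. f v = i} \<subseteq> {nat \<lfloor>P i\<rfloor><..nat \<lfloor>P (Suc i)\<rfloor>}"
    proof
      fix v assume v: "v \<in> {v \<in> {1..n}. f v = i}"
      then have "P i < real v" "real v \<le> P (Suc i)" using f[of v] f'[of v] by auto
      then have "\<lfloor>P i\<rfloor> < int v" "int v \<le> \<lfloor>P (Suc i)\<rfloor>" by (simp_all add: floor_less_iff le_floor_iff)
      then show "v \<in> {nat \<lfloor>P i\<rfloor><..nat \<lfloor>P (Suc i)\<rfloor>}" using v by auto
    qed
    then have "card {v \<in> {1..n}. f v = i} \<le> nat \<lfloor>P (Suc i)\<rfloor> - nat \<lfloor>P i\<rfloor>"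
      using card_mono[of "{nat \<lfloor>P i\<rfloor><..nat \<lfloor>P (Suc i)\<rfloor>}"] by fastforce
    also have "real \<dots> = real_of_int \<lfloor>P (Suc i)\<rfloor> - real_of_int \<lfloor>P i\<rfloor>"
      using Pi pin PS by (simp add: of_nat_diff nat_mono floor_mono)
    also have "\<dots> \<le> p i * n + 1" using PS by linarith
    finally show "real (card {v \<in> {1..n}. f v = i}) \<le> p i * n + 1" by simp
  qed
qed

lemma Rt_le_of_types:
  fixes t :: "nat \<Rightarrow> nat \<Rightarrow> nat" and p :: "nat \<Rightarrow> real"
  assumes ab: "1 \<le> a" "a \<le> b" and r: "1 \<le> r"
    and p: "\<And>i. i < k \<Longrightarrow> 0 \<le> p i" "(\<Sum>i<k. p i) = 1"
    and t: "\<And>i j. i < k \<Longrightarrow> j < k \<Longrightarrow> \<exists>l\<in>{1..r}. 2 \<le> t i l + t j l"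
    and c: "\<And>l. l \<in> {1..r} \<Longrightarrow> (\<Sum>i<k. p i * cost a b (t i l)) \<le> c"
  shows "real (Rt r (complete_bipartite a b) (complete_graph n)) \<le> c * n + k"
proof -
  obtain f where f: "\<And>v. v \<in> {1..n} \<Longrightarrow> f v < k"
    and card: "\<And>i. i < k \<Longrightarrow> real (card {v \<in> {1..n}. f v = i}) \<le> p i * n + 1"
    using proportional_partition[of k p n] p by blast
  have cost: "0 \<le> cost a b m" "cost a b m \<le> 1" for m
    using ab by (auto simp: cost_def)
  define good where "good e l \<longleftrightarrow> l \<in> {1..r} \<and>
    (\<forall>u\<in>e. \<forall>v\<in>e. u \<noteq> v \<longrightarrow> 2 \<le> t (f u) l + t (f v) l)" for e l
  define \<kappa> where "\<kappa> = restrict (\<lambda>e. SOME l. good e l) (edges (complete_graph n))"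
  have good: "good e (\<kappa> e)" if e: "e \<in> edges (complete_graph n)" for e
  proof -
    have "e \<in> [{1..n}]\<^bsup>2\<^esup>" using e by (simp add: complete_graph_def)
    then obtain u v where uv: "u \<in> {1..n}" "v \<in> {1..n}" "e = {u, v}"
      by (rule nsets2_E)
    obtain l where "l \<in> {1..r}" "2 \<le> t (f u) l + t (f v) l"
      using t[OF f[OF uv(1)] f[OF uv(2)]] by blast
    then have "good e l" unfolding good_def uv(3) by (auto simp: add.commute)
    then show ?thesis using e unfolding \<kappa>_def by (simp add: someI)
  qed
  show ?thesis
  proof (rule Rt_le[OF _ r])
    show "\<kappa> \<in> edge_colourings r (complete_graph n)"
      unfolding edge_colourings_def
    proof (rule PiE_I)
      show "\<kappa> e \<in> {1..r}" if "e \<in> edges (complete_graph n)" for e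
        using good[OF that] unfolding good_def by blast
    qed (simp add: \<kappa>_def)
    fix l assume l: "l \<in> {1..r}"
    have "real (mono_packing_number (complete_bipartite a b) (complete_graph n) \<kappa> l)
        \<le> (\<Sum>v=1..n. cost a b (t (f v) l))"
    proof (rule packing_le_cost[OF ab])
      fix u v assume uv: "u \<in> {1..n}" "v \<in> {1..n}" "u \<noteq> v" "\<kappa> {u, v} = l"
      then have "{u, v} \<in> edges (complete_graph n)" by (simp add: complete_graph_def)
      from good[OF this] show "2 \<le> t (f u) l + t (f v) l" using uv unfolding good_def by auto
    qed
    also have "\<dots> = (\<Sum>i<k. \<Sum>v\<in>{v \<in> {1..n}. f v = i}. cost a b (t (f v) l))"
      using f by (intro sum.group[symmetric]) auto
    also have "\<dots> = (\<Sum>i<k. real (card {v \<in> {1..n}. f v = i}) * cost a b (t i l))"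
      by (intro sum.cong) auto
    also have "\<dots> \<le> (\<Sum>i<k. (p i * n + 1) * cost a b (t i l))"
      using card cost by (intro sum_mono mult_right_mono) auto
    also have "\<dots> = (\<Sum>i<k. p i * cost a b (t i l)) * n + (\<Sum>i<k. cost a b (t i l))"
      by (simp add: sum.distrib algebra_simps sum_distrib_left)
    also have "\<dots> \<le> c * n + (\<Sum>i<k. 1)"
      using c[OF l] cost by (intro add_mono mult_right_mono sum_mono) auto
    finally show "real (mono_packing_number (complete_bipartite a b) (complete_graph n) \<kappa> l) \<le> c * n + k"
      by simp
  qed
qed

text \<open>
  Row \<open>i\<close> of each table lists the types of the vertices of class \<open>i\<close> in the four colours. The first
  table has three classes that each dominate one colour by themselves and lets the remaining
  vertices use the fourth colour only. In the other two, the vertices without type 2 use the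
  colour sets \<open>12, 13, 23\<close> and \<open>14, 24, 34, 123\<close>. The class sizes equalise the cost of the four
  colours.
\<close>

lemma Rt_upper_bounds:
  fixes a b n :: nat
  assumes ab: "1 \<le> a" "a \<le> b"
  defines "f \<equiv> real (Rt 4 (complete_bipartite a b) (complete_graph n))"
  shows "f \<le> 1 / (4 * real a + real b) * n + 4"
    and "f \<le> 2 / (5 * real a + 3 * real b) * n + 4"
    and "f \<le> 3 / (5 * (real a + real b)) * n + 4"
proof -
  have I: "{..<4} = {0, 1, 2, 3::nat}" "{1..4} = {1, 2, 3, 4::nat}" by auto
  have pos: "real a > 0" "real b > 0" using ab by auto
  have bound: "f \<le> c * n + 4"
    if p: "\<forall>i\<in>{0, 1, 2, 3}. 0 \<le> p i" "(\<Sum>i\<in>{0, 1, 2, 3}. p i) = 1"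
      and t: "\<forall>i\<in>{0, 1, 2, 3}. \<forall>j\<in>{0, 1, 2, 3}. \<exists>l\<in>{1, 2, 3, 4}. 2 \<le> t i l + t j l"
      and c: "\<forall>l\<in>{1, 2, 3, 4}. (\<Sum>i\<in>{0, 1, 2, 3}. p i * cost a b (t i l)) \<le> c"
    for p :: "nat \<Rightarrow> real" and t :: "nat \<Rightarrow> nat \<Rightarrow> nat" and c
  proof -
    have "f \<le> c * n + real (4::nat)"
      unfolding f_def
    proof (rule Rt_le_of_types[OF ab, where p = p and t = t])
      show "(\<Sum>i<4. p i) = 1" using p(2) by (simp only: I)
      show "(\<Sum>i<4. p i * cost a b (t i l)) \<le> c" if "l \<in> {1..4}" for l
        using c that unfolding I by blast
      show "0 \<le> p i" if "i < 4" for i using p(1) that I(1) by blast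
      show "\<exists>l\<in>{1..4}. 2 \<le> t i l + t j l" if "i < 4" "j < 4" for i j
        using t that I by (metis lessThan_iff)
    qed simp
    then show ?thesis by simp
  qed
  define s where "s = real a + real b"
  have s: "0 < s" using pos by (simp add: s_def)
  have costs: "cost a b 0 = 0" "cost a b (Suc 0) = 1 / s" "cost a b 2 = 1 / a"
    by (simp_all add: cost_def s_def)
  have "f \<le> c * n + 4" if c: "c = 1 / (4 * real a + real b)" for c
  proof -
    have c0: "0 \<le> c" using pos by (simp add: c)
    show ?thesis
    proof (rule bound[where p = "\<lambda>i. [c * a, c * a, c * a, c * s] ! i"
        and t = "\<lambda>i l. [[2,0,0,0], [0,2,0,0], [0,0,2,0], [0,0,0,1]] ! i ! (l - 1)"])
    have "c * (3 * a + s) = 1" using pos by (simp add: c s_def)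
    then show "(\<Sum>i\<in>{0, 1, 2, 3}. [c * a, c * a, c * a, c * s] ! i) = 1" by (simp add: algebra_simps)
  qed (use pos s c0 in \<open>simp_all add: costs\<close>)
  qed
  then show "f \<le> 1 / (4 * real a + real b) * n + 4" by simp
  have "f \<le> c * n + 4" if c: "c = 2 / (5 * real a + 3 * real b)" for c
  proof -
    have c0: "0 \<le> c" using pos by (simp add: c)
    show ?thesis
    proof (rule bound[where p = "\<lambda>i. [c * a, c / 2 * s, c / 2 * s, c / 2 * s] ! i"
        and t = "\<lambda>i l. [[0,0,0,2], [1,1,0,0], [1,0,1,0], [0,1,1,0]] ! i ! (l - 1)"])
    have "5 * real a + 3 * real b \<noteq> 0" using pos by simp
    then have "c * (2 * a + 3 * s) = 2" by (simp add: c s_def field_simps)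
    then show "(\<Sum>i\<in>{0, 1, 2, 3}. [c * a, c / 2 * s, c / 2 * s, c / 2 * s] ! i) = 1"
      by (simp add: algebra_simps)
  qed (use pos s c0 in \<open>simp_all add: costs\<close>)
  qed
  then show "f \<le> 2 / (5 * real a + 3 * real b) * n + 4" by simp
  have "f \<le> c * n + 4" if c: "c = 3 / (5 * (real a + real b))" for c
  proof -
    have c0: "0 \<le> c" using pos by (simp add: c)
    show ?thesis
    proof (rule bound[where p = "\<lambda>i. [c / 3 * s, c / 3 * s, c / 3 * s, 2 * c / 3 * s] ! i"
        and t = "\<lambda>i l. [[1,0,0,1], [0,1,0,1], [0,0,1,1], [1,1,1,0]] ! i ! (l - 1)"])
    have "5 * (c * s) = 3" using s by (simp add: c flip: s_def)
    then show "(\<Sum>i\<in>{0, 1, 2, 3}. [c / 3 * s, c / 3 * s, c / 3 * s, 2 * c / 3 * s] ! i) = 1"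
      by (simp add: algebra_simps)
  qed (use pos s c0 in \<open>simp_all add: costs\<close>)
  qed
  then show "f \<le> 3 / (5 * (real a + real b)) * n + 4" by simp
qed

section \<open>Every colouring has a large packing number\<close>

text \<open>
  Sort the vertices by their values in the four covers. Between two classes that are not small, and
  also within one, Ramsey's theorem finds a biclique of some colour \<open>l\<close> with \<open>b * L\<close> vertices on each
  side, on which the cover of colour \<open>l\<close> is constant on both sides. Applied to its subgraphs
  \<open>K\<^bsub>aL,bL\<^esub>\<close> in both orientations, the cover condition says that the values of \<open>l\<close> on the two
  classes cover an edge between them. After rounding, any two remaining vertices \<open>u\<close>, \<open>v\<close> have a colour in which
  their types add up to at least 2; thus the sets of colours with type 1, over the vertices without
  type 2, form an intersecting family. With the weights \<open>y\<close> of this family every vertex has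
  weighted cost at least 1, and the total weighted cost is bounded by the four covers.
\<close>

lemma card_le_of_covers:
  fixes c :: "nat \<Rightarrow> nat \<Rightarrow> nat" and \<kappa> :: "nat set \<Rightarrow> nat" and \<beta> \<epsilon> :: real and a b L R n :: nat
  assumes ab: "1 \<le> a" "a \<le> b" and L: "1 \<le> L" and pos: "0 < \<beta>" "0 < \<epsilon>"
    and R: "\<forall>(X :: nat set) (Y :: nat set) \<kappa>.
      finite X \<and> finite Y \<and> R \<le> card X \<and> R \<le> card Y \<and> (\<forall>x\<in>X. \<forall>y\<in>Y. \<kappa> x y \<in> {1..4::nat}) \<longrightarrow>
      (\<exists>l\<in>{1..4}. \<exists>X'\<subseteq>X. \<exists>Y'\<subseteq>Y.
          card X' = b * L \<and> card Y' = b * L \<and> (\<forall>x\<in>X'. \<forall>y\<in>Y'. \<kappa> x y = l))"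
    and \<kappa>: "\<And>u v. u \<in> {1..n} \<Longrightarrow> v \<in> {1..n} \<Longrightarrow> u \<noteq> v \<Longrightarrow> \<kappa> {u, v} \<in> {1..4}"
    and cL: "\<And>l v. l \<in> {1..4} \<Longrightarrow> v \<in> {1..n} \<Longrightarrow> c l v \<le> L"
    and cover: "\<And>l X Y. \<lbrakk>l \<in> {1..4}; X \<union> Y \<subseteq> {1..n}; X \<inter> Y = {}; card X = a * L; card Y = b * L;
        \<forall>x\<in>X. \<forall>y\<in>Y. \<kappa> {x, y} = l\<rbrakk>
        \<Longrightarrow> (\<Sum>v=1..n. (1 + \<epsilon>) ^ c l v) \<le> \<beta> * (\<Sum>v\<in>X \<union> Y. (1 + \<epsilon>) ^ c l v)"
  shows "real n \<le> inverse_density a b * (\<beta> * L + 1) + (L + 1) ^ 4 * (2 * R)"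
proof (cases "n = 0")
  case True
  have "0 \<le> inverse_density a b" using le_inverse_density(1)[of a b] by (simp add: order_trans[rotated])
  then show ?thesis using True pos by simp
next
  case False
  define V where "V = {1..n}"
  have V: "finite V" "V \<noteq> {}" "card V = n" using False by (auto simp: V_def)
  define W where "W l = (\<Sum>v\<in>V. (1 + \<epsilon>) ^ c l v)" for l
  \<comment> \<open>Rescaled so that every \<open>K\<^bsub>aL,bL\<^esub>\<close> of colour \<open>l\<close> has weight at least \<open>L\<close>.\<close>
  define p where "p l v = (1 + \<epsilon>) ^ c l v * (\<beta> * L / W l)" for l v
  have W: "0 < W l" for l unfolding W_def using V pos by (intro sum_pos) auto
  have p0: "0 \<le> p l v" for l v using pos W[of l] by (simp add: p_def)
  have psum: "(\<Sum>v\<in>V. p l v) = \<beta> * L" for l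
    using W[of l] unfolding p_def sum_distrib_right[symmetric] W_def[symmetric] by simp
  have pcover: "L \<le> (\<Sum>v\<in>X \<union> Y. p l v)"
    if "l \<in> {1..4}" "X \<union> Y \<subseteq> V" "X \<inter> Y = {}" "card X = a * L" "card Y = b * L"
      "\<forall>x\<in>X. \<forall>y\<in>Y. \<kappa> {x, y} = l" for l X Y
  proof -
    have "W l \<le> \<beta> * (\<Sum>v\<in>X \<union> Y. (1 + \<epsilon>) ^ c l v)"
      using cover that unfolding W_def V_def by blast
    then have "W l * (L / W l) \<le> \<beta> * (\<Sum>v\<in>X \<union> Y. (1 + \<epsilon>) ^ c l v) * (L / W l)"
      using W[of l] by (intro mult_right_mono) auto
    then show ?thesis using W[of l] unfolding p_def sum_distrib_right[symmetric] by (simp add: mult_ac)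
  qed
  define \<tau> where "\<tau> v = restrict (\<lambda>l. c l v) {1..4}" for v
  define cls where "cls v = {u \<in> V. \<tau> u = \<tau> v}" for v
  define U where "U = {v \<in> V. 2 * R \<le> card (cls v)}"
  have finU: "finite U" using V by (simp add: U_def)
  have small: "card (V - U) \<le> (L + 1) ^ 4 * (2 * R)"
  proof (rule ccontr)
    let ?B = "PiE {1..4::nat} (\<lambda>_. {0..L})"
    have "card ?B = (L + 1) ^ 4" by (simp add: card_PiE)
    moreover assume "\<not> ?thesis"
    moreover have "\<tau> ` (V - U) \<subseteq> ?B"
    proof
      fix g assume "g \<in> \<tau> ` (V - U)"
      then obtain v where v: "v \<in> V" "g = \<tau> v" by blast
      show "g \<in> ?B" unfolding v(2) \<tau>_def by (rule restrict_PiE_iff[THEN iffD2]) (use cL v(1) V_def in auto)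
    qed
    ultimately obtain g where g: "2 * R < card {x \<in> V - U. \<tau> x = g}"
      using pigeonhole_fibre[of "V - U" ?B \<tau> "2 * R"] V finite_PiE[of "{1..4::nat}" "\<lambda>_. {0..L}"]
      by (metis finite_Diff finite_atLeastAtMost not_le)
    then have "{x \<in> V - U. \<tau> x = g} \<noteq> {}" by (metis card.empty not_less0)
    then obtain x where x: "x \<in> V" "x \<notin> U" "\<tau> x = g" by blast
    have "card {x \<in> V - U. \<tau> x = g} \<le> card (cls x)"
      using V x by (intro card_mono) (auto simp: cls_def)
    then show False using x g by (simp add: U_def)
  qed
  have compat: "\<exists>l\<in>{1..4}. 1 \<le> a * p l u + b * p l v \<and> 1 \<le> b * p l u + a * p l v"
    if u: "u \<in> U" and v: "v \<in> U" for u v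
  proof -
    have fcls: "finite (cls x)" for x using V by (simp add: cls_def)
    have const: "p l x = p l y" if "l \<in> {1..4}" "x \<in> cls y" for l x y
    proof -
      have "\<tau> x l = \<tau> y l" using that(2) by (simp only: cls_def mem_Collect_eq)
      then have "c l x = c l y" using that(1) by (simp add: \<tau>_def)
      then show ?thesis by (simp add: p_def)
    qed
    \<comment> \<open>The two classes may coincide; they have \<open>2 * R\<close> elements to make room for two disjoint parts.\<close>
    have "R \<le> card (cls u)" using u by (simp add: U_def)
    then obtain X0 where X0: "X0 \<subseteq> cls u" "card X0 = R" "finite X0"
      using obtain_subset_with_card_n by metis
    have "2 * R \<le> card (cls v)" using v by (simp add: U_def)
    then have "R \<le> card (cls v - X0)"
      using X0(2) diff_card_le_card_Diff[OF X0(3), of "cls v"] by linarith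
    then obtain Y0 where Y0: "Y0 \<subseteq> cls v - X0" "card Y0 = R" "finite Y0"
      using obtain_subset_with_card_n by metis
    have sub: "X0 \<subseteq> V" "Y0 \<subseteq> V" using X0 Y0 by (auto simp: cls_def)
    have col: "\<forall>x\<in>X0. \<forall>y\<in>Y0. \<kappa> {x, y} \<in> {1..4}"
    proof (intro ballI)
      fix x y assume "x \<in> X0" "y \<in> Y0"
      then show "\<kappa> {x, y} \<in> {1..4}" using \<kappa>[of x y] sub Y0(1) unfolding V_def by blast
    qed
    obtain l X Y where l: "l \<in> {1..4}" and XY: "X \<subseteq> X0" "Y \<subseteq> Y0" "card X = b * L" "card Y = b * L"
      and mono: "\<forall>x\<in>X. \<forall>y\<in>Y. \<kappa> {x, y} = l"
      using R[rule_format, of X0 Y0 "\<lambda>x y. \<kappa> {x, y}"] X0(2,3) Y0(2,3) col by auto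
    have disj: "X \<inter> Y = {}" using XY Y0 by blast
    have fin: "finite X" "finite Y" using XY X0(3) Y0(3) finite_subset by blast+
    have sum_const: "(\<Sum>x\<in>S. p l x) = card S * p l w" if "S \<subseteq> cls w" for S w
    proof -
      have "(\<Sum>x\<in>S. p l x) = (\<Sum>x\<in>S. p l w)" using const[OF l] that by (intro sum.cong) auto
      then show ?thesis by simp
    qed
    have half: "1 \<le> a * p l w + b * p l z"
      if S: "S \<subseteq> cls w" "T \<subseteq> cls z" "S \<inter> T = {}" "card S = b * L" "card T = b * L"
        "\<forall>x\<in>S. \<forall>y\<in>T. \<kappa> {x, y} = l" "finite T" for S T w z
    proof -
      have "a * L \<le> card S" using ab S by simp
      then obtain S' where S': "S' \<subseteq> S" "card S' = a * L" "finite S'"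
        using obtain_subset_with_card_n by metis
      have "L \<le> (\<Sum>x\<in>S' \<union> T. p l x)"
      proof (rule pcover[OF l])
        show "S' \<union> T \<subseteq> V" using S S' by (auto simp: cls_def)
      qed (use S S' in auto)
      also have "\<dots> = (\<Sum>x\<in>S'. p l x) + (\<Sum>x\<in>T. p l x)"
        using S S' by (intro sum.union_disjoint) auto
      also have "\<dots> = L * (a * p l w + b * p l z)"
        using sum_const[of S' w] sum_const[of T z] S S' by (simp add: algebra_simps)
      finally show ?thesis using L by simp
    qed
    have "1 \<le> a * p l u + b * p l v"
      by (rule half[of X u Y v]) (use XY X0 Y0 disj mono fin in auto)
    moreover have "\<forall>y\<in>Y. \<forall>x\<in>X. \<kappa> {y, x} = l"
    proof (intro ballI)
      fix y x assume "y \<in> Y" "x \<in> X"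
      then have "\<kappa> {x, y} = l" using mono by blast
      then show "\<kappa> {y, x} = l" by (simp add: insert_commute)
    qed
    then have "1 \<le> a * p l v + b * p l u"
      by (intro half[of Y v X u]) (use XY X0 Y0 disj fin in auto)
    ultimately show ?thesis using l by (auto simp: add.commute)
  qed
  have "\<exists>t. (\<forall>v. t v \<le> 2) \<and> (\<Sum>v\<in>U. cost a b (t v)) \<le> (\<Sum>v\<in>U. p l v) + 1 \<and>
      (\<forall>u v. 1 \<le> a * p l u + b * p l v \<longrightarrow> 1 \<le> b * p l u + a * p l v \<longrightarrow> 2 \<le> t u + (t v :: nat))" for l
  proof (rule threshold_rounding[of U a b "p l"])
    show "1 \<le> b" using ab by simp
  qed (use finU ab p0 in auto)
  then obtain t where t2: "\<And>l v. t l v \<le> (2 :: nat)"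
    and tsum: "\<And>l. (\<Sum>v\<in>U. cost a b (t l v)) \<le> (\<Sum>v\<in>U. p l v) + 1"
    and tcompat: "\<And>l u v. 1 \<le> a * p l u + b * p l v \<Longrightarrow> 1 \<le> b * p l u + a * p l v \<Longrightarrow> 2 \<le> t l u + t l v"
    by metis
  have tle: "(\<Sum>v\<in>U. cost a b (t l v)) \<le> \<beta> * L + 1" for l
  proof -
    have "(\<Sum>v\<in>U. p l v) \<le> (\<Sum>v\<in>V. p l v)"
      using V p0 by (intro sum_mono2) (auto simp: U_def)
    then show ?thesis using tsum[of l] psum[of l] by linarith
  qed
  define supp where "supp v = {l \<in> {1..4}. t l v \<noteq> 0}" for v
  define F where "F = supp ` {v \<in> U. \<forall>l\<in>{1..4}. t l v \<noteq> 2}"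
  have rab: "0 < real a" "real a \<le> real b" using ab by auto
  obtain y where ya: "\<And>l. l \<in> {1..4} \<Longrightarrow> real a \<le> y l"
    and ysum: "(\<Sum>l=1..4. y l) \<le> inverse_density a b"
    and yF: "\<And>S. S \<in> F \<Longrightarrow> real a + real b \<le> (\<Sum>l\<in>S. y l)"
  proof (rule intersecting_family_weights[of "{1..4::nat}" "real a" "real b" F])
    show "S \<subseteq> {1..4}" if "S \<in> F" for S using that by (auto simp: F_def supp_def)
    fix S T assume "S \<in> F" "T \<in> F"
    then obtain u v where uv: "u \<in> U" "v \<in> U" "\<forall>l\<in>{1..4}. t l u \<noteq> 2" "\<forall>l\<in>{1..4}. t l v \<noteq> 2"
      "S = supp u" "T = supp v" by (auto simp: F_def)
    obtain l where l: "l \<in> {1..4}" "2 \<le> t l u + t l v"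
      using compat[OF uv(1,2)] tcompat by blast
    have "t l u < 2" "t l v < 2" using uv(3,4) l(1) t2[of l u] t2[of l v] by (metis le_neq_implies_less)+
    then have "l \<in> S \<inter> T" using l unfolding uv(5,6) supp_def by auto
    then show "S \<inter> T \<noteq> {}" by blast
  qed (use rab in auto)
  have y0: "0 \<le> y l" if "l \<in> {1..4}" for l using ya[OF that] by linarith
  have cost0: "0 \<le> cost a b m" for m using rab by (simp add: cost_def)
  have one: "1 \<le> (\<Sum>l=1..4. y l * cost a b (t l v))" if v: "v \<in> U" for v
  proof (cases "\<exists>l\<in>{1..4}. t l v = 2")
    case True
    then obtain l where l: "l \<in> {1..4}" "t l v = 2" by blast
    have "1 \<le> y l * cost a b (t l v)" using ya[OF l(1)] l(2) rab by (simp add: cost_def)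
    also have "\<dots> \<le> (\<Sum>l=1..4. y l * cost a b (t l v))"
      using l(1) y0 cost0 by (intro member_le_sum) auto
    finally show ?thesis .
  next
    case False
    have "1 \<le> (\<Sum>l\<in>supp v. y l) * (1 / (real a + real b))"
      using yF[of "supp v"] v False rab by (auto simp: F_def)
    also have "\<dots> = (\<Sum>l\<in>supp v. y l * (1 / (real a + real b)))" by (rule sum_distrib_right)
    also have "\<dots> = (\<Sum>l\<in>supp v. y l * cost a b (t l v))"
    proof (rule sum.cong[OF refl])
      fix l assume "l \<in> supp v"
      then have "t l v = 1" using False t2[of l v] by (force simp: supp_def)
      then show "y l * (1 / (real a + real b)) = y l * cost a b (t l v)" by (simp add: cost_def)
    qed
    also have "\<dots> \<le> (\<Sum>l=1..4. y l * cost a b (t l v))"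
      using y0 cost0 by (intro sum_mono2) (auto simp: supp_def)
    finally show ?thesis .
  qed
  have "real (card U) = (\<Sum>v\<in>U. 1)" by simp
  also have "\<dots> \<le> (\<Sum>v\<in>U. \<Sum>l=1..4. y l * cost a b (t l v))" using one by (intro sum_mono)
  also have "\<dots> = (\<Sum>l=1..4. y l * (\<Sum>v\<in>U. cost a b (t l v)))"
    by (subst sum.swap) (simp add: sum_distrib_left)
  also have "\<dots> \<le> (\<Sum>l=1..4. y l * (\<beta> * L + 1))"
    using y0 tle by (intro sum_mono mult_left_mono) auto
  also have "\<dots> = (\<Sum>l=1..4. y l) * (\<beta> * L + 1)" by (rule sum_distrib_right[symmetric])
  also have "\<dots> \<le> inverse_density a b * (\<beta> * L + 1)"
    using ysum pos by (intro mult_right_mono) auto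
  finally have big: "real (card U) \<le> inverse_density a b * (\<beta> * L + 1)" .
  have "n = card U + card (V - U)"
    using V card_Diff_subset[OF finU, of V] card_mono[OF V(1), of U] by (auto simp: U_def)
  then have "real n = real (card U) + real (card (V - U))" by simp
  also have "real (card (V - U)) \<le> real ((L + 1) ^ 4 * (2 * R))" using small by (rule of_nat_mono)
  finally show ?thesis using big by simp
qed

text \<open>
  The constants only have to make the bound of the multiplicative weights hold with a cover ratio
  \<open>\<beta>\<close> for which \<open>\<beta> * L = \<sigma> * n\<close> with \<open>\<sigma>\<close> slightly above \<open>\<rho>\<close>. If all packing numbers were less than
  \<open>\<rho> * n\<close>, each colour would have a cover of total value \<open>\<sigma> * n\<close>, which is too little for \<open>n\<close>
  vertices since \<open>\<sigma> * inverse_density a b < 1\<close>.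
\<close>

lemma Rt_lower_bound:
  fixes \<rho> :: real and a b :: nat
  assumes ab: "1 \<le> a" "a \<le> b" and \<rho>: "0 < \<rho>" "\<rho> < 1 / inverse_density a b"
  obtains n0 where "\<And>n. n0 \<le> n \<Longrightarrow>
    nat \<lfloor>\<rho> * n\<rfloor> \<le> Rt 4 (complete_bipartite a b) (complete_graph n)"
proof -
  define M where "M = inverse_density a b"
  have M: "M > 0"
  proof -
    have "0 < 4 * real a + real b" using ab by simp
    then show ?thesis using le_inverse_density(1)[of a b] unfolding M_def by linarith
  qed
  obtain \<sigma> where \<sigma>: "\<rho> < \<sigma>" "\<sigma> < 1 / M" using dense[OF \<rho>(2)] M_def by blast
  have \<sigma>0: "0 < \<sigma>" using \<sigma> \<rho> by linarith
  \<comment> \<open>For small \<open>\<epsilon>\<close>, \<open>1 + \<epsilon>\<close> exceeds \<open>exp (\<epsilon> * x)\<close> because \<open>x < 1\<close>; their ratio \<open>q\<close> to a high power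
     beats the factor \<open>n / \<beta> = L / \<sigma>\<close>.\<close>
  define x where "x = \<rho> / \<sigma>"
  have x: "0 < x" "x < 1" using \<rho> \<sigma> \<sigma>0 by (auto simp: x_def)
  define \<epsilon> where "\<epsilon> = (1 - x) / 2"
  have \<epsilon>: "0 < \<epsilon>" "\<epsilon> < 1" using x by (auto simp: \<epsilon>_def)
  define q where "q = (1 + \<epsilon>) / exp (\<epsilon> * x)"
  have q: "1 < q"
  proof -
    have "\<epsilon> * x < \<epsilon> * (1 - \<epsilon>)" using \<epsilon> x by (intro mult_strict_left_mono) (auto simp: \<epsilon>_def field_simps)
    also have "\<dots> = \<epsilon> - \<epsilon>\<^sup>2" by (simp add: power2_eq_square algebra_simps)
    also have "\<dots> \<le> ln (1 + \<epsilon>)" using \<epsilon> by (intro ln_one_plus_pos_lower_bound) auto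
    finally have "exp (\<epsilon> * x) < exp (ln (1 + \<epsilon>))" by (simp only: exp_less_cancel_iff)
    then have "exp (\<epsilon> * x) < 1 + \<epsilon>" using \<epsilon> by simp
    then show ?thesis by (simp add: q_def)
  qed
  have "(\<lambda>n. of_nat n / q ^ n) \<longlonglongrightarrow> 0" using q by (intro lim_n_over_pown) auto
  then have "\<forall>\<^sub>F n in sequentially. of_nat n / q ^ n < \<sigma>" using \<sigma>0 by (rule order_tendstoD)
  then have "\<forall>\<^sub>F n in sequentially. of_nat n / q ^ n < \<sigma> \<and> 1 \<le> n"
    using eventually_ge_at_top by (rule eventually_conj)
  then obtain L where L: "of_nat L / q ^ L < \<sigma>" "1 \<le> L"
    using eventually_happens'[OF sequentially_bot] by blast
  obtain R where R: "\<forall>(X :: nat set) (Y :: nat set) \<kappa>.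
      finite X \<and> finite Y \<and> R \<le> card X \<and> R \<le> card Y \<and> (\<forall>x\<in>X. \<forall>y\<in>Y. \<kappa> x y \<in> {1..4::nat}) \<longrightarrow>
      (\<exists>l\<in>{1..4}. \<exists>X'\<subseteq>X. \<exists>Y'\<subseteq>Y.
          card X' = b * L \<and> card Y' = b * L \<and> (\<forall>x\<in>X'. \<forall>y\<in>Y'. \<kappa> x y = l))"
    using bipartite_ramsey[OF finite_atLeastAtMost[of 1 "4::nat"], of "b * L"] by (rule exE)
  define K where "K = M + (L + 1) ^ 4 * (2 * R)"
  have M\<sigma>: "0 < 1 - M * \<sigma>" using \<sigma>(2) M by (simp add: pos_less_divide_eq mult.commute)
  define n0 where "n0 = nat \<lceil>K / (1 - M * \<sigma>)\<rceil> + 1"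
  show ?thesis
  proof (rule that[of n0])
    fix n assume n: "n0 \<le> n"
    then have n1: "0 < real n" by (simp add: n0_def)
    have "K / (1 - M * \<sigma>) < n" using n unfolding n0_def by linarith
    then have nK: "K < n * (1 - M * \<sigma>)" using M\<sigma> by (simp add: pos_divide_less_eq)
    define N where "N = nat \<lfloor>\<rho> * n\<rfloor>"
    define \<beta> where "\<beta> = \<sigma> * n / L"
    have \<beta>: "0 < \<beta>" using \<sigma>0 n1 L by (simp add: \<beta>_def)
    have bound: "card {1..n} / \<beta> * (1 + \<epsilon> / \<beta>) ^ N < (1 + \<epsilon>) ^ L"
    proof -
      have "(1 + \<epsilon> / \<beta>) ^ N \<le> exp (\<epsilon> / \<beta>) ^ N"
        using \<epsilon> \<beta> by (intro power_mono exp_ge_add_one_self) auto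
      also have "\<dots> = exp (\<epsilon> / \<beta> * N)" by (simp add: exp_of_nat_mult[symmetric] mult.commute)
      also have "\<dots> \<le> exp (\<epsilon> / \<beta> * (\<rho> * n))"
      proof -
        have "real N \<le> \<rho> * n" unfolding N_def using \<rho> by (intro of_nat_floor) simp
        then show ?thesis using \<epsilon> \<beta> by (intro exp_le_cancel_iff[THEN iffD2] mult_left_mono) auto
      qed
      also have "\<epsilon> / \<beta> * (\<rho> * n) = L * (\<epsilon> * x)" using n1 by (simp add: \<beta>_def x_def)
      finally have "(1 + \<epsilon> / \<beta>) ^ N \<le> exp (\<epsilon> * x) ^ L" by (simp add: exp_of_nat_mult)
      then have "L / \<sigma> * (1 + \<epsilon> / \<beta>) ^ N \<le> L / \<sigma> * exp (\<epsilon> * x) ^ L"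
        using \<sigma>0 by (intro mult_left_mono) auto
      also have "\<dots> < q ^ L * exp (\<epsilon> * x) ^ L"
        using L q \<sigma>0 by (intro mult_strict_right_mono) (auto simp: field_simps)
      also have "\<dots> = (1 + \<epsilon>) ^ L" by (simp add: q_def power_divide)
      also have "L / \<sigma> = card {1..n} / \<beta>" using n1 by (simp add: \<beta>_def)
      finally show ?thesis .
    qed
    show "N \<le> Rt 4 (complete_bipartite a b) (complete_graph n)"
    proof (rule Rt_ge, simp)
      fix \<kappa> assume \<kappa>: "\<kappa> \<in> edge_colourings 4 (complete_graph n)"
      show "\<exists>l\<in>{1..4}. N \<le> mono_packing_number (complete_bipartite a b) (complete_graph n) \<kappa> l"
      proof (rule ccontr)
        assume no: "\<not> ?thesis"
        define biq where "biq l X Y \<longleftrightarrow> X \<union> Y \<subseteq> {1..n} \<and> X \<inter> Y = {} \<and>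
            card X = a * L \<and> card Y = b * L \<and> (\<forall>x\<in>X. \<forall>y\<in>Y. \<kappa> {x, y} = l)" for l X Y
        define cov where "cov l c \<longleftrightarrow> (\<forall>v\<in>{1..n}. c v \<le> L) \<and> (\<forall>X Y. biq l X Y \<longrightarrow>
            (\<Sum>v=1..n. (1 + \<epsilon>) ^ c v) \<le> \<beta> * (\<Sum>v\<in>X \<union> Y. (1 + \<epsilon>) ^ c v))" for l and c :: "nat \<Rightarrow> nat"
        have "\<exists>c. cov l c" if l: "l \<in> {1..4}" for l
        proof (rule packing_or_cover[of "{1..n}" "{X \<union> Y | X Y. biq l X Y}" \<beta> \<epsilon> N L])
          show "{X \<union> Y | X Y. biq l X Y} \<subseteq> Pow {1..n}" unfolding biq_def by blast
        next
          fix K assume K: "\<And>i. i < N \<Longrightarrow> K i \<in> {X \<union> Y | X Y. biq l X Y}"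
            and deg: "\<And>v. v \<in> {1..n} \<Longrightarrow> card {i. i < N \<and> v \<in> K i} \<le> L"
          have "\<forall>i\<in>{..<N}. \<exists>P. K i = fst P \<union> snd P \<and> biq l (fst P) (snd P)"
          proof
            fix i assume "i \<in> {..<N}"
            then obtain X Y where "K i = X \<union> Y" "biq l X Y" using K[of i] by auto
            then show "\<exists>P. K i = fst P \<union> snd P \<and> biq l (fst P) (snd P)" by (intro exI[of _ "(X, Y)"]) simp
          qed
          from bchoice[OF this] obtain P
            where P: "\<forall>i\<in>{..<N}. K i = fst (P i) \<union> snd (P i) \<and> biq l (fst (P i)) (snd (P i))" ..
          have "N \<le> mono_packing_number (complete_bipartite a b) (complete_graph n) \<kappa> l"
          proof (rule packing_ge_of_bicliques[where X = "\<lambda>i. fst (P i)" and Y = "\<lambda>i. snd (P i)" and L = L])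
            fix v assume v: "v \<in> {1..n}"
            have "{i. i < N \<and> v \<in> fst (P i) \<union> snd (P i)} = {i. i < N \<and> v \<in> K i}" using P by auto
            then show "card {i. i < N \<and> v \<in> fst (P i) \<union> snd (P i)} \<le> L" using deg[OF v] by simp
          qed (use P ab L in \<open>simp_all add: biq_def\<close>)
          then show ?thesis using no l by blast
        next
          fix c :: "nat \<Rightarrow> nat"
          assume small: "\<And>v. v \<in> {1..n} \<Longrightarrow> c v \<le> L"
            and heavy: "\<And>K. K \<in> {X \<union> Y | X Y. biq l X Y} \<Longrightarrow>
              (\<Sum>v=1..n. (1 + \<epsilon>) ^ c v) \<le> \<beta> * (\<Sum>v\<in>K. (1 + \<epsilon>) ^ c v)"
          have "cov l c"
            unfolding cov_def
          proof (intro conjI ballI allI impI)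
            fix X Y assume "biq l X Y"
            then show "(\<Sum>v=1..n. (1 + \<epsilon>) ^ c v) \<le> \<beta> * (\<Sum>v\<in>X \<union> Y. (1 + \<epsilon>) ^ c v)"
              by (intro heavy) blast
          qed (rule small)
          then show ?thesis by (rule exI[of _ c])
        qed (use \<beta> \<epsilon> bound in auto)
        then have "\<forall>l\<in>{1..4}. \<exists>c. cov l c" by blast
        from bchoice[OF this] obtain c where c: "\<forall>l\<in>{1..4}. cov l (c l)" ..
        have "real n \<le> inverse_density a b * (\<beta> * L + 1) + (L + 1) ^ 4 * (2 * R)"
        proof (rule card_le_of_covers[OF ab L(2) \<beta> \<epsilon>(1) R, where \<kappa> = \<kappa> and n = n and c = c])
          show "\<kappa> {u, v} \<in> {1..4}" if "u \<in> {1..n}" "v \<in> {1..n}" "u \<noteq> v" for u v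
            using \<kappa> that by (auto simp: edge_colourings_def complete_graph_def PiE_iff)
        next
          fix l X Y assume "l \<in> {1..4::nat}" "X \<union> Y \<subseteq> {1..n}" "X \<inter> Y = {}" "card X = a * L"
            "card Y = b * L" "\<forall>x\<in>X. \<forall>y\<in>Y. \<kappa> {x, y} = l"
          then have "biq l X Y" "cov l (c l)" using c by (simp_all add: biq_def)
          then show "(\<Sum>v=1..n. (1 + \<epsilon>) ^ c l v) \<le> \<beta> * (\<Sum>v\<in>X \<union> Y. (1 + \<epsilon>) ^ c l v)"
            unfolding cov_def by blast
        next
          show "c l v \<le> L" if "l \<in> {1..4}" "v \<in> {1..n}" for l v
            using c that unfolding cov_def by blast
        qed
        also have "\<dots> = M * \<sigma> * n + K" using L by (simp add: \<beta>_def M_def K_def algebra_simps)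
        finally show False using nK by (simp add: algebra_simps)
      qed
    qed
  qed
qed

section \<open>The asymptotic formula\<close>

lemma asymp_linearI:
  fixes f :: "nat \<Rightarrow> nat" and c K :: real
  assumes le: "\<And>n. real (f n) \<le> c * n + K"
    and ge: "\<And>\<rho>. 0 < \<rho> \<Longrightarrow> \<rho> < c \<Longrightarrow> \<exists>n0. \<forall>n\<ge>n0. nat \<lfloor>\<rho> * n\<rfloor> \<le> f n"
    and c: "0 < c"
  shows "asymp_linear f c"
proof -
  have "(\<lambda>n. real (f n) / n) \<longlonglongrightarrow> c"
  proof (rule order_tendstoI)
    fix y assume y: "y < c"
    obtain \<rho> where \<rho>: "max y 0 < \<rho>" "\<rho> < c" using dense[of "max y 0" c] y c by auto
    have "0 < \<rho>" "y < \<rho>" using \<rho> by auto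
    obtain n0 where n0: "\<And>n. n \<ge> n0 \<Longrightarrow> nat \<lfloor>\<rho> * n\<rfloor> \<le> f n" using ge[OF \<open>0 < \<rho>\<close> \<rho>(2)] by blast
    have "(\<lambda>n. \<rho> - 1 / real n) \<longlonglongrightarrow> \<rho> - 0" by (intro tendsto_diff tendsto_const lim_1_over_n)
    then have "\<forall>\<^sub>F n in sequentially. y < \<rho> - 1 / real n" using \<open>y < \<rho>\<close> by (intro order_tendstoD) auto
    then show "\<forall>\<^sub>F n in sequentially. y < real (f n) / n"
      using eventually_ge_at_top[of n0] eventually_gt_at_top[of 0]
    proof eventually_elim
      case (elim n)
      have "\<rho> * n - 1 \<le> f n" using n0[OF elim(2)] by linarith
      then have "(\<rho> * n - 1) / n \<le> f n / n" by (rule divide_right_mono) simp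
      then show ?case using elim by (simp add: diff_divide_distrib)
    qed
  next
    fix y assume y: "c < y"
    have "(\<lambda>n. c + K * (1 / real n)) \<longlonglongrightarrow> c + K * 0"
      by (intro tendsto_add tendsto_mult tendsto_const lim_1_over_n)
    then have "\<forall>\<^sub>F n in sequentially. c + K * (1 / real n) < y" using y by (intro order_tendstoD) auto
    then show "\<forall>\<^sub>F n in sequentially. real (f n) / n < y"
      using eventually_gt_at_top[of 0]
    proof eventually_elim
      case (elim n)
      have "f n / n \<le> (c * n + K) / n" using le[of n] by (rule divide_right_mono) simp
      then show ?case using elim by (simp add: add_divide_distrib)
    qed
  qed
  then have "(\<lambda>n. real (f n) / n - c) \<longlonglongrightarrow> 0" by (rule LIM_zero)
  then have "(\<lambda>n. real (f n) / n - c) \<in> o(\<lambda>_. 1)" by (intro smalloI_tendsto) auto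
  moreover have "\<forall>\<^sub>F n in sequentially. real (f n) = (c + (real (f n) / n - c)) * real n"
    using eventually_gt_at_top[of 0] by eventually_elim simp
  ultimately show ?thesis unfolding asymp_linear_def by blast
qed

theorem theorem6p10:
  fixes a b :: nat
  assumes "1 \<le> a" and "a \<le> b"
  shows "(b \<le> 3 * a \<longrightarrow>
            asymp_linear (\<lambda>n. Rt 4 (complete_bipartite a b) (complete_graph n))
              (1 / (4 * real a + real b))) \<and>
         (3 * a \<le> b \<and> b \<le> 5 * a \<longrightarrow>
            asymp_linear (\<lambda>n. Rt 4 (complete_bipartite a b) (complete_graph n))
              (2 / (5 * real a + 3 * real b))) \<and>
         (5 * a \<le> b \<longrightarrow>
            asymp_linear (\<lambda>n. Rt 4 (complete_bipartite a b) (complete_graph n))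
              (3 / (5 * (real a + real b))))"
proof (intro conjI impI)
  let ?f = "\<lambda>n. Rt 4 (complete_bipartite a b) (complete_graph n)"
  have pos: "0 < real a" "0 < real b" using assms by auto
  have asymp: "asymp_linear ?f c"
    if c: "c = 1 / inverse_density a b" "0 < c" and upper: "\<And>n. real (?f n) \<le> c * n + 4" for c
  proof (rule asymp_linearI[OF upper _ c(2)])
    fix \<rho> :: real assume "0 < \<rho>" "\<rho> < c"
    then obtain n0 where "\<And>n. n0 \<le> n \<Longrightarrow> nat \<lfloor>\<rho> * n\<rfloor> \<le> ?f n"
      using Rt_lower_bound[OF assms, of \<rho>] c(1) by blast
    then show "\<exists>n0. \<forall>n\<ge>n0. nat \<lfloor>\<rho> * n\<rfloor> \<le> ?f n" by blast
  qed
  show "asymp_linear ?f (1 / (4 * real a + real b))" if "b \<le> 3 * a"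
  proof (rule asymp[OF _ _ Rt_upper_bounds(1)[OF assms]])
    have "real b \<le> 3 * real a" using that by linarith
    then have "inverse_density a b = 4 * real a + real b"
      unfolding inverse_density_def by (simp add: max_def)
    then show "1 / (4 * real a + real b) = 1 / inverse_density a b" by simp
  qed (use pos in simp)
  show "asymp_linear ?f (2 / (5 * real a + 3 * real b))" if "3 * a \<le> b \<and> b \<le> 5 * a"
  proof (rule asymp[OF _ _ Rt_upper_bounds(2)[OF assms]])
    have "3 * real a \<le> real b" "real b \<le> 5 * real a" using that by linarith+
    then have "inverse_density a b = (5 * real a + 3 * real b) / 2"
      unfolding inverse_density_def by (auto simp: max_def)
    then show "2 / (5 * real a + 3 * real b) = 1 / inverse_density a b"
      by (simp only: divide_divide_eq_right mult_1_left)
  qed (use pos in simp)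
  show "asymp_linear ?f (3 / (5 * (real a + real b)))" if "5 * a \<le> b"
  proof (rule asymp[OF _ _ Rt_upper_bounds(3)[OF assms]])
    have "5 * real a \<le> real b" using that by linarith
    then have "inverse_density a b = 5 * (real a + real b) / 3"
      unfolding inverse_density_def using pos by (auto simp: max_def)
    then show "3 / (5 * (real a + real b)) = 1 / inverse_density a b"
      by (simp only: divide_divide_eq_right mult_1_left)
  qed (use pos in simp)
qed

end
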